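(* Let $\alpha\ge -\frac12$, $1\le p<\infty$, let $\phi:\mathbb{R}^+\to\mathbb{R}^+$ be a positive measurable function such that $\phi$ is almost decreasing and $r\mapsto r^{d_\alpha/p}\phi(r)$ is almost increasing, and let $\psi$ be a measurable function on $\mathbb{R}$ such that $$K_{\phi,\psi}:=\sup_{r>0}\frac{1}{\phi(r)}\int_{\mathbb{R}}\frac{|\psi(t)|}{|t|^{d_\alpha}}\,\phi\!\left(\frac{r}{|t|}\right)dt<\infty .$$ Then the Dunkl-type Hausdorff operator $\mathcal{H}_\psi^\alpha$ is bounded from $\mathcal{L}^{p,\phi}(\mathbb{R},d\mu_\alpha)$ to $\mathcal{L}^{p,\phi}(\mathbb{R},d\mu_\alpha)$, and for all $f\in\mathcal{L}^{p,\phi}(\mathbb{R},d\mu_\alpha)$ $$\|\mathcal{H}_\psi^\alpha f\|_{\mathcal{L}^{p,\phi}(\mathbb{R},d\mu_\alpha)}\le K_{\phi,\psi}\,\|f\|_{\mathcal{L}^{p,\phi}(\mathbb{R},d\mu_\alpha)} .$$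
   Context: Notation: $d_\alpha=2\alpha+2$; $d\mu_\alpha(x)=A_\alpha|x|^{2\alpha+1}dx$ with $A_\alpha=(2^{\alpha+1}\Gamma(\alpha+1))^{-1}$; $B(0,r)=\,]-r,r[$ for $r>0$. A function $\theta:\,]0,\infty[\,\to\,]0,\infty[$ is almost increasing (almost decreasing) if there is $C>0$ with $\theta(r)\le C\theta(s)$ (resp. $\theta(r)\ge C\theta(s)$) for $r\le s$. Dunkl translation: put $W_\alpha(x,y,z)=(1-\sigma_{x,y,z}+\sigma_{z,x,y}+\sigma_{z,y,x})\,\kappa_\alpha(|x|,|y|,|z|)$, where $\sigma_{x,y,z}=\frac{x^2+y^2-z^2}{2xy}$ if $x,y\in\mathbb{R}\setminus\{0\}$ and $0$ otherwise, and $$\kappa_\alpha(|x|,|y|,|z|)=D_\alpha\frac{\big([(|x|+|y|)^2-z^2][z^2-(|x|-|y|)^2]\big)^{\alpha-\frac12}}{|xyz|^{2\alpha}}$$ if $|z|\in[\,||x|-|y||,\,|x|+|y|\,]$ and $0$ otherwise, with $D_\alpha=\frac{(\Gamma(\alpha+1))^2}{2^{\alpha-1}\sqrt{\pi}\,\Gamma(\alpha+\frac12)}$. Let $d\nu_{x,y}(z)=W_\alpha(x,y,z)\,d\mu_\alpha(z)$ if $x,y\ne0$, $\nu_{x,0}=\delta_x$, $\nu_{0,y}=\delta_y$. Then $\tau_x^\alpha f(y)=\int_{\mathbb{R}}f(z)\,d\nu_{x,y}(z)$ (for continuous $f$, and by the same formula for more general functions). For $\alpha=-\frac12$, $\tau_x^\alpha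 f(y)=f(x+y)$. Generalized Dunkl-type Campanato space: $\mathcal{L}^{p,\phi}(\mathbb{R},d\mu_\alpha)$ is the space of locally $p$-integrable $f$ on $\mathbb{R}$ with $$\|f\|_{\mathcal{L}^{p,\phi}(\mathbb{R},d\mu_\alpha)}:=\sup_{r>0,\,x\in\mathbb{R}}\frac{1}{\phi(r)}\left(\frac{1}{\mu_\alpha(B(0,r))}\int_{B(0,r)}|\tau_x^\alpha f(y)-f^\alpha_{B(0,r)}(x)|^p\,d\mu_\alpha(y)\right)^{1/p}<\infty,$$ where $f^\alpha_{B(0,r)}(x)=\frac{1}{\mu_\alpha(B(0,r))}\int_{B(0,r)}\tau_x^\alpha f(y)\,d\mu_\alpha(y)$. Dunkl-type Hausdorff operator: $\mathcal{H}_\psi^\alpha f(x):=\int_{\mathbb{R}}\frac{\psi(t)}{|t|^{2\alpha+2}}f\!\left(\frac{x}{t}\right)dt$.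
   Formalization: The integral defining the Hausdorff operator need not converge under these hypotheses (e.g. α=-1/2, p=1, φ(r)=1/r, ψ the indicator of (0,1), f=1); it is read as 0 at points where it does not converge absolutely, and its convergence is not claimed. *)

theory Defs
  imports "HOL-Analysis.Analysis"
begin

definition almost_increasing :: "(real \<Rightarrow> real) \<Rightarrow> bool" where
  "almost_increasing \<theta> \<longleftrightarrow> (\<exists>C>0. \<forall>r s. 0 < r \<longrightarrow> r \<le> s \<longrightarrow> \<theta> r \<le> C * \<theta> s)"

definition almost_decreasing :: "(real \<Rightarrow> real) \<Rightarrow> bool" where
  "almost_decreasing \<theta> \<longleftrightarrow> (\<exists>C>0. \<forall>r s. 0 < r \<longrightarrow> r \<le> s \<longrightarrow> \<theta> r \<ge> C * \<theta> s)"

definition dunkl_dim :: "real \<Rightarrow> real" where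
  "dunkl_dim \<alpha> = 2 * \<alpha> + 2"

text \<open>In all definitions below, \<open>0 powr a = 0\<close> (for every \<open>a\<close>) and \<open>x / 0 = 0\<close> only affect
  integrands on Lebesgue null sets.\<close>

definition dunkl_measure :: "real \<Rightarrow> real measure" where
  "dunkl_measure \<alpha> =
     density lebesgue
       (\<lambda>x. ennreal (inverse (2 powr (\<alpha> + 1) * Gamma (\<alpha> + 1)) * \<bar>x\<bar> powr (2 * \<alpha> + 1)))"

definition dunkl_sigma :: "real \<Rightarrow> real \<Rightarrow> real \<Rightarrow> real" where
  "dunkl_sigma x y z =
     (if x \<noteq> 0 \<and> y \<noteq> 0 then (x\<^sup>2 + y\<^sup>2 - z\<^sup>2) / (2 * x * y) else 0)"

definition dunkl_kappa :: "real \<Rightarrow> real \<Rightarrow> real \<Rightarrow> real \<Rightarrow> real" where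
  "dunkl_kappa \<alpha> a b c =
     (if c \<in> {\<bar>a - b\<bar>..a + b}
      then (Gamma (\<alpha> + 1))\<^sup>2 / (2 powr (\<alpha> - 1) * sqrt pi * Gamma (\<alpha> + 1/2))
           * (((a + b)\<^sup>2 - c\<^sup>2) * (c\<^sup>2 - (a - b)\<^sup>2)) powr (\<alpha> - 1/2)
           / \<bar>a * b * c\<bar> powr (2 * \<alpha>)
      else 0)"

definition dunkl_W :: "real \<Rightarrow> real \<Rightarrow> real \<Rightarrow> real \<Rightarrow> real" where
  "dunkl_W \<alpha> x y z =
     (1 - dunkl_sigma x y z + dunkl_sigma z x y + dunkl_sigma z y x)
     * dunkl_kappa \<alpha> \<bar>x\<bar> \<bar>y\<bar> \<bar>z\<bar>"

text \<open>The kernel formula is used for \<open>\<alpha> > -1/2\<close>; the branches \<open>y = 0\<close> and \<open>x = 0\<close> are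
  integration against the Dirac measures at \<open>x\<close> and at \<open>y\<close>.\<close>

definition dunkl_translation ::
  "real \<Rightarrow> real \<Rightarrow> (real \<Rightarrow> complex) \<Rightarrow> real \<Rightarrow> complex" where
  "dunkl_translation \<alpha> x f y =
     (if \<alpha> = -1/2 then f (x + y)
      else if y = 0 then f x
      else if x = 0 then f y
      else (LINT z|dunkl_measure \<alpha>. dunkl_W \<alpha> x y z *\<^sub>R f z))"

definition dunkl_mean :: "real \<Rightarrow> (real \<Rightarrow> complex) \<Rightarrow> real \<Rightarrow> real \<Rightarrow> complex" where
  "dunkl_mean \<alpha> f r x =
     (LINT y:ball 0 r|dunkl_measure \<alpha>. dunkl_translation \<alpha> x f y)
       /\<^sub>R measure (dunkl_measure \<alpha>) (ball 0 r)"

definition ennreal_power :: "ennreal \<Rightarrow> real \<Rightarrow> ennreal" where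
  "ennreal_power X q = (if X = \<infinity> then \<infinity> else ennreal (enn2real X powr q))"

definition campanato_norm ::
  "real \<Rightarrow> real \<Rightarrow> (real \<Rightarrow> real) \<Rightarrow> (real \<Rightarrow> complex) \<Rightarrow> ennreal" where
  "campanato_norm \<alpha> p \<phi> f =
     (SUP r\<in>{0<..}. SUP x.
        ennreal_power
          ((\<integral>\<^sup>+ y\<in>ball 0 r.
               ennreal (cmod (dunkl_translation \<alpha> x f y - dunkl_mean \<alpha> f r x) powr p)
             \<partial>dunkl_measure \<alpha>)
           / emeasure (dunkl_measure \<alpha>) (ball 0 r))
          (1 / p)
        / ennreal (\<phi> r))"

definition locally_p_integrable :: "real \<Rightarrow> real \<Rightarrow> (real \<Rightarrow> complex) \<Rightarrow> bool" where
  "locally_p_integrable \<alpha> p f \<longleftrightarrow>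
     f \<in> borel_measurable lebesgue \<and>
     (\<forall>K. compact K \<longrightarrow> set_integrable (dunkl_measure \<alpha>) K (\<lambda>x. cmod (f x) powr p))"

definition campanato_space ::
  "real \<Rightarrow> real \<Rightarrow> (real \<Rightarrow> real) \<Rightarrow> (real \<Rightarrow> complex) set" where
  "campanato_space \<alpha> p \<phi> =
     {f. locally_p_integrable \<alpha> p f \<and> campanato_norm \<alpha> p \<phi> f < \<infinity>}"

text \<open>A Bochner integral: at points \<open>x\<close> where the integrand is not absolutely integrable
  the value is \<open>0\<close>. No convergence is assumed anywhere.\<close>

definition dunkl_hausdorff ::
  "real \<Rightarrow> (real \<Rightarrow> complex) \<Rightarrow> (real \<Rightarrow> complex) \<Rightarrow> real \<Rightarrow> complex" where
  "dunkl_hausdorff \<alpha> \<psi> f x =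
     (LINT t|lebesgue. \<psi> t / of_real (\<bar>t\<bar> powr (2 * \<alpha> + 2)) * f (x / t))"

definition hausdorff_const ::
  "real \<Rightarrow> (real \<Rightarrow> real) \<Rightarrow> (real \<Rightarrow> complex) \<Rightarrow> ennreal" where
  "hausdorff_const \<alpha> \<phi> \<psi> =
     (SUP r\<in>{0<..}.
        (\<integral>\<^sup>+ t. ennreal (cmod (\<psi> t) / \<bar>t\<bar> powr dunkl_dim \<alpha> * \<phi> (r / \<bar>t\<bar>)) \<partial>lebesgue)
        / ennreal (\<phi> r))"

end

theory Submission
  imports Defs
begin

text \<open>Write \<open>f\<^sub>t z = f (z / t)\<close>. The kernel of the Dunkl translation is homogeneous, so
  \<open>\<tau>\<^sub>x f\<^sub>t y = \<tau>\<^bsub>x/t\<^esub> f (y / t)\<close> and the oscillation of \<open>f\<^sub>t\<close> on \<open>ball 0 r\<close> is that of \<open>f\<close> on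
  \<open>ball 0 (r / \<bar>t\<bar>)\<close>, which is at most \<open>\<phi> (r / \<bar>t\<bar>)\<close> times the norm of \<open>f\<close>. Since the Hausdorff
  operator is the superposition of the \<open>f\<^sub>t\<close> with weights \<open>\<psi> t / \<bar>t\<bar>\<^sup>d\<close>, Minkowski's integral
  inequality gives the bound once the translation and the mean may be taken under the integral.

  No convergence is assumed, but there is a dichotomy. Up to integrable errors controlled by
  the norm of \<open>f\<close>, absolute convergence of the defining integral at almost every point of a ball
  is equivalent to the integrability against \<open>\<psi> t / \<bar>t\<bar>\<^sup>d\<close> of the means of the \<open>f\<^sub>t\<close> over that ball.
  Hence either the integral converges absolutely almost everywhere, with a locally
  integrable majorant, so that Fubini's theorem applies, or it diverges almost everywhere and
  the operator returns \<open>0\<close> almost everywhere.\<close>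

section \<open>A weighted Minkowski inequality\<close>

text \<open>The dichotomy is forced by the constants, which the norm cannot see.
  \<open>hausdorff_const\<close> controls \<psi> only together with \<phi> (r / |t|), so \<psi> t /
  |t|^d by itself may fail to be integrable, and then the defining integral diverges for f = 1
  although this function has norm 0. What the norm does control is the deviation of each dilate from
  its mean, and the superposition of these deviations converges whether or not the operator does.
  Taking the translation under the integral is a separate difficulty, because the kernel
  \<open>dunkl_W\<close> changes sign and the majorant supplied by the dichotomy is only locally
  integrable. The remedy is a bound on the integral of |W| over y, uniform in x and z: it gives
  absolute convergence for almost every y, which is all that the oscillation sees. Fubini's theorem
  also demands joint measurability of (t, z) -> f (z / t). The functions f and \<psi> are therefore
  replaced by Borel functions equal to them almost everywhere, and the result is transferred back at
  the end.\<close>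

lemma powr_ge_tangent:
  fixes a h p :: real
  assumes "1 \<le> p" "0 \<le> a" "0 \<le> h"
  shows "p * a powr (p - 1) * h \<le> h powr p + (p - 1) * a powr p"
proof (cases "p = 1")
  case True
  \<comment> \<open>The power \<open>a powr 0\<close> is 1 for positive \<open>a\<close> but 0 for
    \<open>a = 0\<close>, hence the split.\<close>
  then show ?thesis using assms by (cases "a = 0") auto
next
  case False
  with assms have p: "p > 1" by simp
  \<comment> \<open>The conjugate exponent: (p - 1) q = p, so Young's inequality for h and a^(p-1),
    multiplied by p, is the claim.\<close>
  define q where "q = p / (p - 1)"
  have q: "q > 1" "1/p + 1/q = 1" using p by (auto simp: q_def field_simps)
  have "h * a powr (p - 1) \<le> h powr p / p + (a powr (p - 1)) powr q / q"
    using Youngs_inequality[of p q h "a powr (p - 1)"] p q assms by auto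
  moreover have "(a powr (p - 1)) powr q = a powr p"
    using p by (simp add: powr_powr q_def)
  ultimately have "p * (h * a powr (p - 1)) \<le> p * (h powr p / p + a powr p / q)"
    using p by (intro mult_left_mono) auto
  also have "\<dots> = h powr p + (p - 1) * a powr p"
    using p by (simp add: q_def field_simps)
  finally show ?thesis by (simp add: mult_ac)
qed

lemma ennreal_power_nn_integral_le:
  fixes w h :: "'a \<Rightarrow> real"
  assumes [measurable]: "w \<in> borel_measurable M" "h \<in> borel_measurable M"
    and w: "\<And>x. 0 \<le> w x" and h: "\<And>x. 0 \<le> h x" and p: "1 \<le> p"
    and S: "(\<integral>\<^sup>+x. ennreal (w x) \<partial>M) = ennreal S" "0 \<le> S"
  shows "ennreal_power (\<integral>\<^sup>+x. ennreal (w x * h x) \<partial>M) p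
           \<le> ennreal (S powr (p - 1)) * (\<integral>\<^sup>+x. ennreal (w x * h x powr p) \<partial>M)"
proof -
  let ?I = "\<integral>\<^sup>+x. ennreal (w x * h x) \<partial>M" and ?J = "\<integral>\<^sup>+x. ennreal (w x * h x powr p) \<partial>M"
  have tangent: "ennreal (p * a powr (p - 1)) * ?I \<le> ?J + ennreal ((p - 1) * a powr p * S)"
    if "0 \<le> a" for a
  proof -
    have "ennreal (p * a powr (p - 1)) * ?I = (\<integral>\<^sup>+x. ennreal (p * a powr (p - 1)) * ennreal (w x * h x) \<partial>M)"
      by (rule nn_integral_cmult[symmetric]) simp
    also have "\<dots> = (\<integral>\<^sup>+x. ennreal (p * a powr (p - 1) * (w x * h x)) \<partial>M)"
      using p w h by (intro nn_integral_cong) (simp add: ennreal_mult)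
    also have "\<dots> \<le> (\<integral>\<^sup>+x. ennreal (w x * h x powr p) + ennreal ((p - 1) * a powr p) * ennreal (w x) \<partial>M)"
    proof (rule nn_integral_mono)
      fix x
      have "w x * (p * a powr (p - 1) * h x) \<le> w x * (h x powr p + (p - 1) * a powr p)"
        by (intro mult_left_mono powr_ge_tangent p that h w)
      then have "ennreal (p * a powr (p - 1) * (w x * h x))
          \<le> ennreal (w x * h x powr p + (p - 1) * a powr p * w x)"
        by (intro ennreal_leI) (simp add: algebra_simps)
      also have "\<dots> = ennreal (w x * h x powr p) + ennreal ((p - 1) * a powr p) * ennreal (w x)"
        using p w h by (simp add: ennreal_plus ennreal_mult)
      finally show "ennreal (p * a powr (p - 1) * (w x * h x))
          \<le> ennreal (w x * h x powr p) + ennreal ((p - 1) * a powr p) * ennreal (w x)" .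
    qed
    also have "\<dots> = ?J + ennreal ((p - 1) * a powr p) * (\<integral>\<^sup>+x. ennreal (w x) \<partial>M)"
      by (subst nn_integral_add) (auto simp: nn_integral_cmult)
    also have "\<dots> = ?J + ennreal ((p - 1) * a powr p * S)"
      unfolding S(1) using p S by (simp add: ennreal_mult)
    finally show ?thesis .
  qed
  show ?thesis
  proof (cases "S = 0")
    \<comment> \<open>The right-hand side is 0 here, even for \<open>p = 1\<close> (as
      \<open>0 powr 0 = 0\<close>) and for an infinite second factor, so the left-hand side has to
      vanish: the weight is 0 almost everywhere.\<close>
    case True
    with S have "(\<integral>\<^sup>+x. ennreal (w x) \<partial>M) = 0" by simp
    then have "AE x in M. ennreal (w x) = 0" by (subst (asm) nn_integral_0_iff_AE) auto
    then have "AE x in M. ennreal (w x * h x) = 0"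
      by eventually_elim (use w in \<open>auto simp: ennreal_eq_0_iff mult_nonpos_nonneg h\<close>)
    then have "?I = 0" by (subst nn_integral_0_iff_AE) auto
    then show ?thesis using p by (simp add: ennreal_power_def)
  next
    case False
    with S have S0: "S > 0" by simp
    show ?thesis
    proof (cases "?J = \<infinity>")
      case True
      then show ?thesis using S0 by (simp add: ennreal_mult_top)
    next
      case False
      then obtain j where j: "?J = ennreal j" "0 \<le> j" by (cases ?J) auto
      \<comment> \<open>The tangent at 1 only serves to make the first integral finite, so that its
        mean can be formed next.\<close>
      have "ennreal p * ?I < \<infinity>"
        using tangent[of 1] j S p by (simp flip: ennreal_plus add: order_le_less_trans)
      with p have "?I \<noteq> \<infinity>" by (auto simp: ennreal_mult_eq_top_iff)
      then obtain i where i: "?I = ennreal i" "0 \<le> i" by (cases ?I) auto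
      \<comment> \<open>The optimal point of tangency is the \<open>w\<close>-mean
        \<open>i / S\<close> of \<open>h\<close>; there the terms on both sides are multiples of i^p
        / S^(p-1).\<close>
      have "ennreal (p * (i/S) powr (p - 1)) * ?I \<le> ?J + ennreal ((p - 1) * (i/S) powr p * S)"
        using i S0 by (intro tangent) auto
      then have *: "p * (i/S) powr (p - 1) * i \<le> j + (p - 1) * (i/S) powr p * S"
        unfolding i(1) j(1) using i j p S0 by (simp flip: ennreal_plus ennreal_mult)
      have "i powr p \<le> S powr (p - 1) * j"
      proof (cases "i = 0")
        case True then show ?thesis using j p by simp
      next
        case False
        with i have i0: "i > 0" by simp
        have 1: "(i/S) powr (p - 1) * i = i powr p / S powr (p - 1)"
          using i0 S0 by (simp add: powr_divide powr_diff)
        have 2: "(i/S) powr p * S = i powr p / S powr (p - 1)"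
          using i0 S0 by (simp add: powr_divide powr_diff)
        have "p * (i powr p / S powr (p - 1)) \<le> j + (p - 1) * (i powr p / S powr (p - 1))"
          using * unfolding 1[symmetric] by (simp add: 1 2 mult.assoc)
        then have "i powr p / S powr (p - 1) \<le> j" 
          by (simp only: left_diff_distrib mult_1)
        then show ?thesis using S0 by (simp add: field_simps)
      qed
      then show ?thesis unfolding i(1) j(1) using i j
        by (simp add: ennreal_power_def flip: ennreal_mult)
    qed
  qed
qed

lemma measurable_ennreal_power [measurable (raw)]:
  assumes [measurable]: "f \<in> borel_measurable M"
  shows "(\<lambda>x. ennreal_power (f x) q) \<in> borel_measurable M"
  unfolding ennreal_power_def by measurable

text \<open>Minkowski's integral inequality, in a weighted form that follows from Jensen's inequality
  for the measure \<open>k n\<close> applied to \<open>g / n\<close>.\<close>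

lemma (in pair_sigma_finite) weighted_minkowski:
  fixes g :: "'a \<Rightarrow> 'b \<Rightarrow> real" and k n :: "'a \<Rightarrow> real"
  assumes [measurable]: "case_prod g \<in> borel_measurable (M1 \<Otimes>\<^sub>M M2)"
      "k \<in> borel_measurable M1" "n \<in> borel_measurable M1"
    and g: "\<And>t y. 0 \<le> g t y" and k: "\<And>t. 0 \<le> k t" and n: "\<And>t. 0 < n t" and p: "1 \<le> p"
    and S: "(\<integral>\<^sup>+t. ennreal (k t * n t) \<partial>M1) = ennreal S" "0 \<le> S"
    and bound: "AE t in M1. (\<integral>\<^sup>+y. ennreal (g t y powr p) \<partial>M2) \<le> ennreal (n t powr p) * Q"
  shows "(\<integral>\<^sup>+y. ennreal_power (\<integral>\<^sup>+t. ennreal (k t * g t y) \<partial>M1) p \<partial>M2) \<le> ennreal (S powr p) * Q"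
proof -
  let ?c = "ennreal (S powr (p - 1))"
  have "(\<integral>\<^sup>+y. ennreal_power (\<integral>\<^sup>+t. ennreal (k t * g t y) \<partial>M1) p \<partial>M2)
      \<le> (\<integral>\<^sup>+y. ?c * (\<integral>\<^sup>+t. ennreal (k t * n t * (g t y / n t) powr p) \<partial>M1) \<partial>M2)"
  proof (rule nn_integral_mono)
    fix y assume [measurable]: "y \<in> space M2"
    have "k t * g t y = k t * n t * (g t y / n t)" for t
      using n[of t] by simp
    then show "ennreal_power (\<integral>\<^sup>+t. ennreal (k t * g t y) \<partial>M1) p
        \<le> ?c * (\<integral>\<^sup>+t. ennreal (k t * n t * (g t y / n t) powr p) \<partial>M1)"
      using ennreal_power_nn_integral_le[of "\<lambda>t. k t * n t" M1 "\<lambda>t. g t y / n t" p S]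
        k n g p S by (simp add: less_imp_le)
  qed
  also have "\<dots> = ?c * (\<integral>\<^sup>+y. (\<integral>\<^sup>+t. ennreal (k t * n t * (g t y / n t) powr p) \<partial>M1) \<partial>M2)"
    by (rule nn_integral_cmult) measurable
  also have "\<dots> = ?c * (\<integral>\<^sup>+t. (\<integral>\<^sup>+y. ennreal (k t * n t * (g t y / n t) powr p) \<partial>M2) \<partial>M1)"
    by (subst Fubini') simp_all
  also have "\<dots> \<le> ?c * (\<integral>\<^sup>+t. ennreal (k t * n t) * Q \<partial>M1)"
  proof (rule mult_left_mono[OF nn_integral_mono_AE])
    show "AE t in M1. (\<integral>\<^sup>+y. ennreal (k t * n t * (g t y / n t) powr p) \<partial>M2) \<le> ennreal (k t * n t) * Q"
      using bound AE_space
    proof eventually_elim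
      fix t assume t: "(\<integral>\<^sup>+y. ennreal (g t y powr p) \<partial>M2) \<le> ennreal (n t powr p) * Q"
        and [measurable]: "t \<in> space M1"
      have "(\<integral>\<^sup>+y. ennreal (k t * n t * (g t y / n t) powr p) \<partial>M2)
          = (\<integral>\<^sup>+y. ennreal (k t * n t / n t powr p) * ennreal (g t y powr p) \<partial>M2)"
        using k n[of t] g by (intro nn_integral_cong)
          (simp flip: ennreal_mult add: powr_divide less_imp_le mult_ac)
      also have "\<dots> = ennreal (k t * n t / n t powr p) * (\<integral>\<^sup>+y. ennreal (g t y powr p) \<partial>M2)"
        by (rule nn_integral_cmult) measurable
      also have "\<dots> \<le> ennreal (k t * n t / n t powr p) * (ennreal (n t powr p) * Q)"
        by (intro mult_left_mono t) simp
      also have "\<dots> = ennreal (k t * n t) * Q"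
        using k[of t] n[of t] by (simp flip: mult.assoc ennreal_mult)
      finally show "(\<integral>\<^sup>+y. ennreal (k t * n t * (g t y / n t) powr p) \<partial>M2) \<le> ennreal (k t * n t) * Q" .
    qed
  qed simp
  \<comment> \<open>One factor S is the mass of \<open>k n\<close>; Jensen's inequality contributed
    the other p - 1.\<close>
  also have "\<dots> = ?c * (ennreal S * Q)"
    by (subst nn_integral_multc) (simp_all add: S)
  also have "\<dots> = ennreal (S powr p) * Q"
    using S p by (cases "S = 0") (simp_all add: powr_diff flip: mult.assoc ennreal_mult)
  finally show ?thesis .
qed

section \<open>Null sets and Borel versions\<close>

text \<open>Up to the point \<open>c\<close>, the new exceptional set lies in the image under
  \<open>g\<close> of the old one, and differentiable maps of the line send null sets to null sets.
  Removing 0 from the old set leaves room for a pole of \<open>g\<close>, as in the reflection s ->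
  c / s.\<close>

lemma AE_lebesgue_compose:
  fixes g h :: "real \<Rightarrow> real"
  assumes ae: "AE x in lebesgue. P x"
    and g: "g differentiable_on (- {0})"
    and inv: "\<And>x. x \<noteq> c \<Longrightarrow> g (h x) = x \<and> h x \<noteq> 0"
  shows "AE x in lebesgue. P (h x)"
proof -
  have "{x. \<not> P x} \<in> null_sets lebesgue"
    using ae by (simp add: completion.AE_iff_null_sets)
  then have "negligible ({x. \<not> P x} - {0})"
    by (intro negligible_diff) (simp add: negligible_iff_null_sets)
  then have "negligible (g ` ({x. \<not> P x} - {0}))"
    by (rule negligible_differentiable_image_negligible[rotated]) (auto intro: differentiable_on_subset[OF g])
  moreover have "{x. \<not> P (h x)} \<subseteq> insert c (g ` ({x. \<not> P x} - {0}))"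
  proof
    fix x assume "x \<in> {x. \<not> P (h x)}"
    then show "x \<in> insert c (g ` ({x. \<not> P x} - {0}))"
      using inv[of x] by (cases "x = c") (auto intro!: image_eqI[of x g "h x"])
  qed
  ultimately have "negligible {x. \<not> P (h x)}"
    by (meson negligible_insert negligible_subset)
  then show ?thesis
    by (simp add: completion.AE_iff_null_sets negligible_iff_null_sets)
qed

lemma AE_lebesgue_divide:
  fixes c :: real
  assumes "AE x in lebesgue. P x" and "c \<noteq> 0"
  shows "AE t in lebesgue. P (c / t)"
proof (rule AE_lebesgue_compose[OF assms(1)])
  show "(\<lambda>s. c / s) differentiable_on - {0}"
    unfolding differentiable_on_def by (intro ballI differentiable_divide differentiable_const differentiable_ident) simp
  show "c / (c / t) = t \<and> c / t \<noteq> 0" if "t \<noteq> 0" for t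
    using that assms(2) by simp
qed

lemma AE_lebesgue_plus:
  fixes x :: real
  assumes "AE x in lebesgue. P x"
  shows "AE y in lebesgue. P (x + y)"
proof (rule AE_lebesgue_compose[OF assms])
  show "(\<lambda>s. s - x) differentiable_on - {0}"
    unfolding differentiable_on_def by (intro ballI differentiable_diff differentiable_const differentiable_ident)
  show "x + y - x = y \<and> x + y \<noteq> 0" if "y \<noteq> - x" for y
    using that by simp
qed

lemma AE_lebesgue_neq: "AE x in lebesgue. x \<noteq> (c::real)"
  by (simp add: completion.AE_iff_null_sets)

lemma borel_measurable_lebesgue_AE_eq:
  fixes f g :: "'a::euclidean_space \<Rightarrow> 'b::topological_space"
  assumes "AE x in lebesgue. f x = g x" and g: "g \<in> borel_measurable lebesgue"
  shows "f \<in> borel_measurable lebesgue"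
proof (rule measurableI)
  fix A :: "'b set" assume A: "A \<in> sets borel"
  show "f -` A \<inter> space lebesgue \<in> sets lebesgue"
  proof (rule completion.in_sets_AE)
    show "AE x in lebesgue. x \<in> g -` A \<inter> space lebesgue \<longleftrightarrow> x \<in> f -` A \<inter> space lebesgue"
      using assms(1) by eventually_elim simp
    show "g -` A \<inter> space lebesgue \<in> sets lebesgue"
      using g A by (rule measurable_sets)
    show "f -` A \<inter> space lebesgue \<subseteq> space lebesgue"
      by (rule Int_lower2)
  qed
qed simp

lemma ex_borel_version_complex:
  fixes f :: "'a::euclidean_space \<Rightarrow> complex"
  assumes f: "f \<in> borel_measurable lebesgue"
  obtains g where "g \<in> borel_measurable borel" "AE x in lebesgue. f x = g x"
proof -
  have "(\<lambda>x. Re (f x)) \<in> borel_measurable lebesgue" "(\<lambda>x. Im (f x)) \<in> borel_measurable lebesgue"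
    using f by measurable
  from this[THEN completion_ex_borel_measurable_real] obtain a b
    where [measurable]: "a \<in> borel_measurable borel" "b \<in> borel_measurable borel"
      and ab: "AE x in lborel. Re (f x) = a x" "AE x in lborel. Im (f x) = b x" by auto
  show ?thesis
  proof
    show "(\<lambda>x. Complex (a x) (b x)) \<in> borel_measurable borel"
      unfolding Complex_eq by measurable
    show "AE x in lebesgue. f x = Complex (a x) (b x)"
      using AE_completion[OF ab(1)] AE_completion[OF ab(2)]
      by eventually_elim (auto simp: complex_eq_iff)
  qed
qed

lemma integral_lebesgue_AE_eq:
  fixes f g :: "'a::euclidean_space \<Rightarrow> 'b::{banach, second_countable_topology}"
  assumes "AE x in lebesgue. f x = g x" and [measurable]: "g \<in> borel_measurable borel"
  shows "integral\<^sup>L lebesgue f = integral\<^sup>L lborel g"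
proof -
  have "integral\<^sup>L lebesgue f = integral\<^sup>L lebesgue g"
    using assms by (intro integral_cong_AE borel_measurable_lebesgue_AE_eq[OF assms(1)])
      (auto intro: measurable_completion)
  also have "\<dots> = integral\<^sup>L lborel g"
    by (rule integral_completion) simp
  finally show ?thesis .
qed

section \<open>The Dunkl measure\<close>

definition dunkl_weight :: "real \<Rightarrow> real \<Rightarrow> real" where
  "dunkl_weight \<alpha> x = inverse (2 powr (\<alpha> + 1) * Gamma (\<alpha> + 1)) * \<bar>x\<bar> powr (2 * \<alpha> + 1)"

text \<open>The Dunkl measure before completion. Product measurability of (t, z) -> f (z / t) is
  available on Borel sigma-algebras, so every use of Fubini's theorem takes place over this
  measure.\<close>

definition dunkl_lborel :: "real \<Rightarrow> real measure" where
  "dunkl_lborel \<alpha> = density lborel (\<lambda>x. ennreal (dunkl_weight \<alpha> x))"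

lemma dunkl_measure_eq: "dunkl_measure \<alpha> = density lebesgue (\<lambda>x. ennreal (dunkl_weight \<alpha> x))"
  by (simp add: dunkl_measure_def dunkl_weight_def)

lemma measurable_dunkl_weight [measurable]: "dunkl_weight \<alpha> \<in> borel_measurable borel"
  unfolding dunkl_weight_def by measurable

lemma measurable_dunkl_weight_lebesgue [measurable]: "dunkl_weight \<alpha> \<in> borel_measurable lebesgue"
  by (rule measurable_completion) simp

lemma sets_dunkl_lborel [simp, measurable_cong]: "sets (dunkl_lborel \<alpha>) = sets borel"
  by (simp add: dunkl_lborel_def)

lemma space_dunkl_lborel [simp]: "space (dunkl_lborel \<alpha>) = UNIV"
  by (simp add: dunkl_lborel_def)

lemma sets_dunkl_measure [simp, measurable_cong]: "sets (dunkl_measure \<alpha>) = sets lebesgue"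
  by (simp add: dunkl_measure_eq)

lemma space_dunkl_measure [simp]: "space (dunkl_measure \<alpha>) = UNIV"
  by (simp add: dunkl_measure_eq)

interpretation dunkl: sigma_finite_measure "dunkl_lborel \<alpha>" for \<alpha>
  using lborel.sigma_finite_measure_axioms unfolding dunkl_lborel_def
  by (rule sigma_finite_measure.sigma_finite_iff_density_finite[THEN iffD2]) auto

interpretation lborel_dunkl: pair_sigma_finite lborel "dunkl_lborel \<alpha>" for \<alpha>
  by unfold_locales

interpretation dunkl_dunkl: pair_sigma_finite "dunkl_lborel \<alpha>" "dunkl_lborel \<alpha>" for \<alpha>
  by unfold_locales

lemma dunkl_weight_nonneg: "\<alpha> > -1 \<Longrightarrow> 0 \<le> dunkl_weight \<alpha> x"
  by (simp add: dunkl_weight_def Gamma_real_nonneg)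

lemma dunkl_weight_pos: "\<alpha> > -1 \<Longrightarrow> x \<noteq> 0 \<Longrightarrow> 0 < dunkl_weight \<alpha> x"
  by (simp add: dunkl_weight_def Gamma_real_pos)

text \<open>The density vanishes only at the origin, so the Dunkl measure and Lebesgue measure have
  the same null sets.\<close>

lemma AE_dunkl_iff:
  assumes "\<alpha> > -1"
  shows "(AE x in dunkl_lborel \<alpha>. P x) \<longleftrightarrow> (AE x in lebesgue. P x)"
    and "(AE x in dunkl_measure \<alpha>. P x) \<longleftrightarrow> (AE x in lebesgue. P x)"
proof -
  have *: "AE x in lebesgue. ennreal (dunkl_weight \<alpha> x) > 0"
    using AE_lebesgue_neq[of 0] by eventually_elim (simp add: dunkl_weight_pos assms)
  have **: "(AE x in lebesgue. 0 < ennreal (dunkl_weight \<alpha> x) \<longrightarrow> P x) \<longleftrightarrow> (AE x in lebesgue. P x)"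
  proof
    assume "AE x in lebesgue. 0 < ennreal (dunkl_weight \<alpha> x) \<longrightarrow> P x"
    with * show "AE x in lebesgue. P x" by eventually_elim simp
  next
    assume "AE x in lebesgue. P x"
    then show "AE x in lebesgue. 0 < ennreal (dunkl_weight \<alpha> x) \<longrightarrow> P x" by eventually_elim simp
  qed
  show "(AE x in dunkl_lborel \<alpha>. P x) \<longleftrightarrow> (AE x in lebesgue. P x)"
    unfolding dunkl_lborel_def using ** by (subst AE_density) (simp_all only: AE_completion_iff, simp)
  show "(AE x in dunkl_measure \<alpha>. P x) \<longleftrightarrow> (AE x in lebesgue. P x)"
    unfolding dunkl_measure_eq using ** by (subst AE_density) simp_all
qed

lemma nn_integral_dunkl_measure:
  assumes [measurable]: "f \<in> borel_measurable borel"
  shows "nn_integral (dunkl_measure \<alpha>) f = nn_integral (dunkl_lborel \<alpha>) f"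
proof -
  have [measurable]: "f \<in> borel_measurable lebesgue" by (rule measurable_completion) simp
  show ?thesis
    unfolding dunkl_measure_eq dunkl_lborel_def
    by (simp add: nn_integral_density nn_integral_completion)
qed

lemma nn_integral_dunkl_measure_AE_eq:
  assumes "\<alpha> > -1" "AE x in lebesgue. f x = g x" "g \<in> borel_measurable borel"
  shows "nn_integral (dunkl_measure \<alpha>) f = nn_integral (dunkl_lborel \<alpha>) g"
proof -
  have "nn_integral (dunkl_measure \<alpha>) f = nn_integral (dunkl_measure \<alpha>) g"
    using assms by (intro nn_integral_cong_AE) (simp add: AE_dunkl_iff)
  then show ?thesis using assms(3) by (simp add: nn_integral_dunkl_measure)
qed

lemma integral_dunkl_measure_AE_eq:
  fixes f :: "real \<Rightarrow> 'b::{banach, second_countable_topology}"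
  assumes "\<alpha> > -1" "AE x in lebesgue. f x = g x" and [measurable]: "g \<in> borel_measurable borel"
  shows "integral\<^sup>L (dunkl_measure \<alpha>) f = integral\<^sup>L (dunkl_lborel \<alpha>) g"
proof -
  have [measurable]: "g \<in> borel_measurable lebesgue" by (rule measurable_completion) simp
  have "integral\<^sup>L (dunkl_measure \<alpha>) f = integral\<^sup>L (dunkl_measure \<alpha>) g"
    using assms borel_measurable_lebesgue_AE_eq[OF assms(2)]
    by (intro integral_cong_AE) (auto simp: AE_dunkl_iff)
  also have "\<dots> = integral\<^sup>L (dunkl_lborel \<alpha>) g"
    unfolding dunkl_measure_eq dunkl_lborel_def using dunkl_weight_nonneg[OF assms(1)]
    by (simp add: integral_density integral_completion)
  finally show ?thesis .
qed

lemma dunkl_weight_mult: "dunkl_weight \<alpha> (c * x) = \<bar>c\<bar> powr (2 * \<alpha> + 1) * dunkl_weight \<alpha> x"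
  by (simp add: dunkl_weight_def abs_mult powr_mult)

text \<open>The Jacobian |c| and the homogeneity |c|^(2\<alpha>+1) of the weight combine to |c|^d,
  which is the sense in which d is a dimension.\<close>

lemma nn_integral_dunkl_scale:
  assumes [measurable]: "f \<in> borel_measurable borel" and c: "c \<noteq> 0" and \<alpha>: "\<alpha> > -1"
  shows "nn_integral (dunkl_lborel \<alpha>) f
           = ennreal (\<bar>c\<bar> powr dunkl_dim \<alpha>) * (\<integral>\<^sup>+x. f (c * x) \<partial>dunkl_lborel \<alpha>)"
proof -
  have "nn_integral (dunkl_lborel \<alpha>) f = (\<integral>\<^sup>+x. ennreal (dunkl_weight \<alpha> x) * f x \<partial>lborel)"
    by (simp add: dunkl_lborel_def nn_integral_density)
  also have "\<dots> = ennreal \<bar>c\<bar> * (\<integral>\<^sup>+x. ennreal (dunkl_weight \<alpha> (c * x)) * f (c * x) \<partial>lborel)"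
    using nn_integral_real_affine[of "\<lambda>x. ennreal (dunkl_weight \<alpha> x) * f x" c 0] c by simp
  also have "\<dots> = ennreal \<bar>c\<bar> * (\<integral>\<^sup>+x. ennreal (\<bar>c\<bar> powr (2 * \<alpha> + 1)) * (ennreal (dunkl_weight \<alpha> x) * f (c * x)) \<partial>lborel)"
    using \<alpha> by (simp add: dunkl_weight_mult ennreal_mult dunkl_weight_nonneg mult.assoc)
  also have "\<dots> = ennreal \<bar>c\<bar> * (ennreal (\<bar>c\<bar> powr (2 * \<alpha> + 1)) * (\<integral>\<^sup>+x. ennreal (dunkl_weight \<alpha> x) * f (c * x) \<partial>lborel))"
    by (subst nn_integral_cmult) auto
  also have "\<dots> = ennreal (\<bar>c\<bar> powr dunkl_dim \<alpha>) * (\<integral>\<^sup>+x. ennreal (dunkl_weight \<alpha> x) * f (c * x) \<partial>lborel)"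
    using c by (simp add: dunkl_dim_def powr_mult_base flip: mult.assoc ennreal_mult) (simp add: add.commute)
  finally show ?thesis by (simp add: dunkl_lborel_def nn_integral_density)
qed

lemma integral_dunkl_scale:
  fixes f :: "real \<Rightarrow> 'b::{banach, second_countable_topology}"
  assumes [measurable]: "f \<in> borel_measurable borel" and c: "c \<noteq> 0" and \<alpha>: "\<alpha> > -1"
  shows "integral\<^sup>L (dunkl_lborel \<alpha>) f = \<bar>c\<bar> powr dunkl_dim \<alpha> *\<^sub>R (LINT x|dunkl_lborel \<alpha>. f (c * x))"
proof -
  have "integral\<^sup>L (dunkl_lborel \<alpha>) f = (LINT x|lborel. dunkl_weight \<alpha> x *\<^sub>R f x)"
    using dunkl_weight_nonneg[OF \<alpha>] by (simp add: dunkl_lborel_def integral_density)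
  also have "\<dots> = \<bar>c\<bar> *\<^sub>R (LINT x|lborel. dunkl_weight \<alpha> (c * x) *\<^sub>R f (c * x))"
    using lborel_integral_real_affine[of c "\<lambda>x. dunkl_weight \<alpha> x *\<^sub>R f x" 0] c by simp
  also have "\<dots> = \<bar>c\<bar> powr dunkl_dim \<alpha> *\<^sub>R (LINT x|lborel. dunkl_weight \<alpha> x *\<^sub>R f (c * x))"
    using c by (simp add: dunkl_dim_def dunkl_weight_mult powr_mult_base flip: scaleR_scaleR) (simp add: add.commute powr_mult_base)
  also have "\<dots> = \<bar>c\<bar> powr dunkl_dim \<alpha> *\<^sub>R (LINT x|dunkl_lborel \<alpha>. f (c * x))"
    using dunkl_weight_nonneg[OF \<alpha>] by (simp add: dunkl_lborel_def integral_density)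
  finally show ?thesis .
qed

lemma emeasure_dunkl_ball_pos:
  assumes "\<alpha> > -1" "0 < r"
  shows "0 < emeasure (dunkl_lborel \<alpha>) (ball 0 r)"
proof (rule ccontr)
  assume "\<not> ?thesis"
  then have "ball 0 r \<in> null_sets (dunkl_lborel \<alpha>)" by auto
  then have "AE x in dunkl_lborel \<alpha>. x \<notin> ball (0::real) r" by (rule AE_not_in)
  then have "AE x in lborel. x \<notin> ball (0::real) r" by (simp add: AE_dunkl_iff assms AE_completion_iff)
  then have "ball (0::real) r \<in> null_sets lborel"
    by (subst AE_iff_null_sets) auto
  then have "negligible (ball 0 r :: real set)"
    by (simp add: negligible_iff_null_sets null_sets_completionI)
  then show False
    using assms open_not_negligible[of "ball 0 r :: real set"] by auto
qed

text \<open>For \<alpha> \<ge> -1/2 the exponent of the weight is nonnegative, so on the ball the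
  weight is at most its value at the radius.\<close>

lemma emeasure_dunkl_ball_finite:
  assumes "\<alpha> \<ge> -1/2"
  shows "emeasure (dunkl_lborel \<alpha>) (ball 0 r) < \<infinity>"
proof -
  have "emeasure (dunkl_lborel \<alpha>) (ball 0 r) = (\<integral>\<^sup>+x. ennreal (dunkl_weight \<alpha> x) * indicator (ball 0 r) x \<partial>lborel)"
    by (simp add: dunkl_lborel_def emeasure_density)
  also have "\<dots> \<le> (\<integral>\<^sup>+x. ennreal (dunkl_weight \<alpha> r) * indicator (ball (0::real) r) x \<partial>lborel)"
  proof (rule nn_integral_mono)
    fix x :: real
    show "ennreal (dunkl_weight \<alpha> x) * indicator (ball 0 r) x \<le> ennreal (dunkl_weight \<alpha> r) * indicator (ball 0 r) x"
    proof (cases "x \<in> ball 0 r")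
      case True
      then have "\<bar>x\<bar> powr (2 * \<alpha> + 1) \<le> \<bar>r\<bar> powr (2 * \<alpha> + 1)"
        using assms by (intro powr_mono2) auto
      then have "dunkl_weight \<alpha> x \<le> dunkl_weight \<alpha> r"
        unfolding dunkl_weight_def using assms by (intro mult_left_mono) (auto intro!: Gamma_real_nonneg)
      then show ?thesis by (intro mult_right_mono ennreal_leI) auto
    qed simp
  qed
  also have "\<dots> = ennreal (dunkl_weight \<alpha> r) * emeasure lborel (ball (0::real) r)"
    by (simp add: nn_integral_cmult_indicator)
  also have "\<dots> < \<infinity>"
    using emeasure_lborel_ball_finite by (auto simp: ennreal_mult_less_top)
  finally show ?thesis .
qed

section \<open>The kernel\<close>

lemma measurable_dunkl_sigma [measurable (raw)]:
  assumes [measurable]: "f \<in> borel_measurable M" "g \<in> borel_measurable M" "h \<in> borel_measurable M"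
  shows "(\<lambda>x. dunkl_sigma (f x) (g x) (h x)) \<in> borel_measurable M"
  unfolding dunkl_sigma_def by measurable

lemma measurable_dunkl_W [measurable (raw)]:
  assumes [measurable]: "f \<in> borel_measurable M" "g \<in> borel_measurable M" "h \<in> borel_measurable M"
  shows "(\<lambda>x. dunkl_W \<alpha> (f x) (g x) (h x)) \<in> borel_measurable M"
  unfolding dunkl_W_def dunkl_kappa_def atLeastAtMost_iff by measurable

lemma heron_nonneg:
  fixes a b c :: real
  assumes "\<bar>a - b\<bar> \<le> c" "c \<le> a + b"
  shows "0 \<le> (a + b)\<^sup>2 - c\<^sup>2" "0 \<le> c\<^sup>2 - (a - b)\<^sup>2"
  using power_mono[of c "a + b" 2] power_mono[of "\<bar>a - b\<bar>" c 2] assms by auto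

text \<open>Counting degrees: the product of differences of squares has degree 4 and is raised to
  the power \<alpha> - 1/2, the denominator has degree 6\<alpha>, and 4\<alpha> - 2 - 6\<alpha> =
  -d. This is exactly inverse to the scaling of the measure.\<close>

lemma dunkl_kappa_scale:
  assumes s: "0 < s" and abc: "0 \<le> a" "0 \<le> b" "0 \<le> c"
  shows "dunkl_kappa \<alpha> (s * a) (s * b) (s * c) = s powr (- dunkl_dim \<alpha>) * dunkl_kappa \<alpha> a b c"
proof (cases "c \<in> {\<bar>a - b\<bar>..a + b}")
  case True
  have 1: "s * c \<in> {\<bar>s * a - s * b\<bar>..s * a + s * b}"
    using True s mult_left_mono[of "\<bar>a - b\<bar>" c s] mult_left_mono[of c "a + b" s]
    by (simp add: abs_mult flip: right_diff_distrib distrib_left)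
  let ?P = "((a + b)\<^sup>2 - c\<^sup>2) * (c\<^sup>2 - (a - b)\<^sup>2)"
  have P: "?P \<ge> 0" using True by (intro mult_nonneg_nonneg heron_nonneg) simp_all
  have "((s * a + s * b)\<^sup>2 - (s * c)\<^sup>2) * ((s * c)\<^sup>2 - (s * a - s * b)\<^sup>2) = s ^ 4 * ?P"
    by algebra
  also have "(s ^ 4 * ?P) powr (\<alpha> - 1/2) = s powr (4 * \<alpha> - 2) * ?P powr (\<alpha> - 1/2)"
  proof -
    have "(s ^ 4) powr (\<alpha> - 1/2) = s powr (4 * \<alpha> - 2)"
      using powr_powr[of s 4 "\<alpha> - 1/2"] s by (simp add: right_diff_distrib)
    then show ?thesis using P by (subst powr_mult) simp_all
  qed
  finally have 2: "(((s * a + s * b)\<^sup>2 - (s * c)\<^sup>2) * ((s * c)\<^sup>2 - (s * a - s * b)\<^sup>2)) powr (\<alpha> - 1/2)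
      = s powr (4 * \<alpha> - 2) * ?P powr (\<alpha> - 1/2)" .
  have "\<bar>s * a * (s * b) * (s * c)\<bar> = s ^ 3 * \<bar>a * b * c\<bar>"
    using s abc by (simp add: abs_mult power3_eq_cube)
  also have "(s ^ 3 * \<bar>a * b * c\<bar>) powr (2 * \<alpha>) = s powr (6 * \<alpha>) * \<bar>a * b * c\<bar> powr (2 * \<alpha>)"
    using powr_powr[of s 3 "2 * \<alpha>"] s by (subst powr_mult) simp_all
  finally have 3: "\<bar>s * a * (s * b) * (s * c)\<bar> powr (2 * \<alpha>) = s powr (6 * \<alpha>) * \<bar>a * b * c\<bar> powr (2 * \<alpha>)" .
  have 4: "s powr (4 * \<alpha> - 2) = s powr (- dunkl_dim \<alpha>) * s powr (6 * \<alpha>)"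
    by (simp add: dunkl_dim_def flip: powr_add)
  show ?thesis
    unfolding dunkl_kappa_def 2 3 4 using 1 True s by (simp add: mult_ac)
next
  case False
  then have "s * c \<notin> {\<bar>s * a - s * b\<bar>..s * a + s * b}"
    using s by (simp add: abs_mult flip: right_diff_distrib distrib_left)
  then show ?thesis using False by (simp only: dunkl_kappa_def if_False mult_zero_right)
qed

lemma dunkl_sigma_scale:
  assumes "t \<noteq> 0"
  shows "dunkl_sigma (t * x) (t * y) (t * z) = dunkl_sigma x y z"
proof -
  have "((t * x)\<^sup>2 + (t * y)\<^sup>2 - (t * z)\<^sup>2) = t\<^sup>2 * (x\<^sup>2 + y\<^sup>2 - z\<^sup>2)" "2 * (t * x) * (t * y) = t\<^sup>2 * (2 * x * y)"
    by (simp_all add: power2_eq_square algebra_simps)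
  then show ?thesis
    unfolding dunkl_sigma_def using assms by (simp only: mult_eq_0_iff mult_divide_mult_cancel_left power_not_zero) simp
qed

text \<open>The \<sigma> terms are invariant under negative factors too, and \<kappa> sees only
  absolute values, so reflections are included. This matters because t ranges over the whole
  line.\<close>

lemma dunkl_W_scale:
  assumes "t \<noteq> 0"
  shows "dunkl_W \<alpha> (t * x) (t * y) (t * z) = \<bar>t\<bar> powr (- dunkl_dim \<alpha>) * dunkl_W \<alpha> x y z"
  using assms by (simp add: dunkl_W_def dunkl_sigma_scale abs_mult dunkl_kappa_scale)

text \<open>By the law of cosines this is, up to sign, the cosine of the angle between the sides |x|
  and |y| of a triangle whose third side is |z|; the assumptions are the triangle
  inequalities.\<close>

lemma abs_dunkl_sigma_le_1:
  assumes "\<bar>\<bar>x\<bar> - \<bar>y\<bar>\<bar> \<le> \<bar>z\<bar>" "\<bar>z\<bar> \<le> \<bar>x\<bar> + \<bar>y\<bar>"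
  shows "\<bar>dunkl_sigma x y z\<bar> \<le> 1"
proof (cases "x \<noteq> 0 \<and> y \<noteq> 0")
  case True
  have "\<bar>x\<^sup>2 + y\<^sup>2 - z\<^sup>2\<bar> \<le> 2 * \<bar>x\<bar> * \<bar>y\<bar>"
    using heron_nonneg[of "\<bar>x\<bar>" "\<bar>y\<bar>" "\<bar>z\<bar>"] assms
    by (auto simp: power2_sum power2_diff abs_le_iff)
  then show ?thesis using True by (simp add: dunkl_sigma_def abs_mult)
qed (auto simp: dunkl_sigma_def)

lemma dunkl_kappa_nonneg:
  assumes "\<alpha> > -1/2"
  shows "0 \<le> dunkl_kappa \<alpha> a b c"
  using assms by (auto simp: dunkl_kappa_def intro!: divide_nonneg_nonneg mult_nonneg_nonneg Gamma_real_nonneg)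

text \<open>On the support of \<kappa> the triangle condition holds. It is symmetric in the three
  sides, so each of the three \<sigma> terms is at most 1 in absolute value, and the leading 1 makes
  the total 4. Off the support both sides vanish.\<close>

lemma abs_dunkl_W_le:
  assumes "\<alpha> > -1/2"
  shows "\<bar>dunkl_W \<alpha> x y z\<bar> \<le> 4 * dunkl_kappa \<alpha> \<bar>x\<bar> \<bar>y\<bar> \<bar>z\<bar>"
proof (cases "\<bar>z\<bar> \<in> {\<bar>\<bar>x\<bar> - \<bar>y\<bar>\<bar>..\<bar>x\<bar> + \<bar>y\<bar>}")
  case True
  have "\<bar>dunkl_sigma x y z\<bar> \<le> 1" "\<bar>dunkl_sigma z x y\<bar> \<le> 1" "\<bar>dunkl_sigma z y x\<bar> \<le> 1"
    using True by (intro abs_dunkl_sigma_le_1; simp; linarith)+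
  then have "\<bar>1 - dunkl_sigma x y z + dunkl_sigma z x y + dunkl_sigma z y x\<bar> \<le> 4"
    by linarith
  then show ?thesis
    unfolding dunkl_W_def abs_mult using dunkl_kappa_nonneg[OF assms] by (simp add: mult_right_mono)
next
  case False
  then have "dunkl_kappa \<alpha> \<bar>x\<bar> \<bar>y\<bar> \<bar>z\<bar> = 0" by (simp only: dunkl_kappa_def if_False)
  then show ?thesis by (simp add: dunkl_W_def)
qed

lemma dunkl_W_eq_0: "\<bar>x\<bar> + \<bar>y\<bar> < \<bar>z\<bar> \<Longrightarrow> dunkl_W \<alpha> x y z = 0"
  by (simp add: dunkl_W_def dunkl_kappa_def)

text \<open>The product under the power is a multiple of the squared area of the triangle, hence symmetric
  in its sides; as a function of \<open>b\<^sup>2\<close>, normalised to \<open>u\<close>, it is the density of a beta integral.\<close>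

lemma dunkl_kappa_weight:
  fixes a b c \<alpha> :: real
  defines "u \<equiv> (b\<^sup>2 - (a - c)\<^sup>2) / (4 * a * c)"
  assumes pos: "0 < a" "0 < b" "0 < c" and b: "b \<in> {\<bar>a - c\<bar>..a + c}"
  shows "dunkl_kappa \<alpha> a b c * b powr (2 * \<alpha> + 1)
    = (Gamma (\<alpha> + 1))\<^sup>2 / (2 powr (\<alpha> - 1) * sqrt pi * Gamma (\<alpha> + 1/2)) * 4 powr (2 * \<alpha> - 1) * 2
        * ((u * (1 - u)) powr (\<alpha> - 1/2) * (b / (2 * a * c)))"
proof -
  let ?D = "(Gamma (\<alpha> + 1))\<^sup>2 / (2 powr (\<alpha> - 1) * sqrt pi * Gamma (\<alpha> + 1/2))"
  have c: "c \<in> {\<bar>a - b\<bar>..a + b}" using b by auto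
  have u1: "b\<^sup>2 - (a - c)\<^sup>2 = 4 * a * c * u" using pos by (simp add: u_def)
  then have u2: "(a + c)\<^sup>2 - b\<^sup>2 = 4 * a * c * (1 - u)"
    by (simp add: power2_sum power2_diff algebra_simps)
  have "((a + b)\<^sup>2 - c\<^sup>2) * (c\<^sup>2 - (a - b)\<^sup>2) = ((a + c)\<^sup>2 - b\<^sup>2) * (b\<^sup>2 - (a - c)\<^sup>2)"
    by (simp add: power2_eq_square algebra_simps)
  also have "\<dots> = (4 * (a * c)) ^ 2 * (u * (1 - u))"
    unfolding u1 u2 by (simp add: power2_eq_square algebra_simps)
  finally have P: "((a + b)\<^sup>2 - c\<^sup>2) * (c\<^sup>2 - (a - b)\<^sup>2) = (4 * (a * c)) ^ 2 * (u * (1 - u))" .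
  have "0 \<le> ((a + b)\<^sup>2 - c\<^sup>2) * (c\<^sup>2 - (a - b)\<^sup>2)"
    using c by (intro mult_nonneg_nonneg heron_nonneg) simp_all
  then have uu: "0 \<le> u * (1 - u)"
    unfolding P using pos by (simp add: zero_le_mult_iff)
  have "(((a + b)\<^sup>2 - c\<^sup>2) * (c\<^sup>2 - (a - b)\<^sup>2)) powr (\<alpha> - 1/2)
     = (4 * (a * c)) powr (2 * \<alpha> - 1) * (u * (1 - u)) powr (\<alpha> - 1/2)"
  proof -
    have "((4 * (a * c)) ^ 2) powr (\<alpha> - 1/2) = (4 * (a * c)) powr (2 * \<alpha> - 1)"
      using powr_powr[of "4 * (a * c)" 2 "\<alpha> - 1/2"] pos by (simp add: right_diff_distrib)
    then show ?thesis unfolding P using uu by (subst powr_mult) simp_all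
  qed
  also have "(4 * (a * c)) powr (2 * \<alpha> - 1) = 4 powr (2 * \<alpha> - 1) * (a * c) powr (2 * \<alpha>) / (a * c)"
    using pos by (simp add: powr_mult powr_diff)
  finally have 1: "(((a + b)\<^sup>2 - c\<^sup>2) * (c\<^sup>2 - (a - b)\<^sup>2)) powr (\<alpha> - 1/2)
     = 4 powr (2 * \<alpha> - 1) * (a * c) powr (2 * \<alpha>) / (a * c) * (u * (1 - u)) powr (\<alpha> - 1/2)" .
  have 2: "\<bar>a * b * c\<bar> powr (2 * \<alpha>) = (a * c) powr (2 * \<alpha>) * b powr (2 * \<alpha>)"
    using pos by (simp add: powr_mult)
  have 3: "b powr (2 * \<alpha> + 1) = b powr (2 * \<alpha>) * b"
    using pos by (simp add: powr_add)
  have 4: "b powr (2 * \<alpha>) \<noteq> 0" "(a * c) powr (2 * \<alpha>) \<noteq> 0" using pos by auto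
  have "dunkl_kappa \<alpha> a b c * b powr (2 * \<alpha> + 1)
     = ?D * (4 powr (2 * \<alpha> - 1) * (a * c) powr (2 * \<alpha>) / (a * c) * (u * (1 - u)) powr (\<alpha> - 1/2))
         / ((a * c) powr (2 * \<alpha>) * b powr (2 * \<alpha>)) * (b powr (2 * \<alpha>) * b)"
    unfolding dunkl_kappa_def 1 2 3 using c by simp
  also have "\<dots> = ?D * 4 powr (2 * \<alpha> - 1) * 2 * ((u * (1 - u)) powr (\<alpha> - 1/2) * (b / (2 * a * c)))"
  proof -
    have gen: "D * (F * A / ac * G) / (A * B) * (B * b) = D * F * 2 * (G * (b / (2 * ac)))"
      if "A \<noteq> 0" "B \<noteq> 0" for D F A ac G B :: real
      using that by simp
    show ?thesis using gen[OF 4(2) 4(1), of ?D "4 powr (2 * \<alpha> - 1)" "a * c"] by (simp add: mult.assoc)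
  qed
  finally show ?thesis .
qed

text \<open>The map b -> u increases from 0 to 1 on the interval of admissible sides, and
  \<open>b / (2 * a * c)\<close> is its derivative. The value does not depend on \<open>a\<close>
  and \<open>c\<close>; this is where the uniformity of the kernel bound comes from.\<close>

lemma nn_integral_beta_substitution:
  fixes a c q :: real
  assumes pos: "0 < a" "0 < c"
  shows "(\<integral>\<^sup>+b. ennreal ((let u = (b\<^sup>2 - (a - c)\<^sup>2) / (4 * a * c) in (u * (1 - u)) powr q * (b / (2 * a * c)))
            * indicator {\<bar>a - c\<bar>..a + c} b) \<partial>lborel)
       = (\<integral>\<^sup>+u. ennreal ((u * (1 - u)) powr q * indicator {0..1} u) \<partial>lborel)"
proof -
  let ?g = "\<lambda>b. (b\<^sup>2 - (a - c)\<^sup>2) / (4 * a * c)"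
  have g: "?g \<bar>a - c\<bar> = 0" "?g (a + c) = 1"
    using pos by (simp_all add: power2_sum power2_diff)
  have "(\<integral>\<^sup>+u. ennreal ((u * (1 - u)) powr q * indicator {?g \<bar>a - c\<bar>..?g (a + c)} u) \<partial>lborel)
     = (\<integral>\<^sup>+b. ennreal ((?g b * (1 - ?g b)) powr q * (b / (2 * a * c)) * indicator {\<bar>a - c\<bar>..a + c} b) \<partial>lborel)"
  proof (rule nn_integral_substitution)
    show "set_borel_measurable borel {?g \<bar>a - c\<bar>..?g (a + c)} (\<lambda>u. (u * (1 - u)) powr q)"
      unfolding set_borel_measurable_def by measurable
    show "(?g has_real_derivative b / (2 * a * c)) (at b)" for b
      using pos by (auto intro!: derivative_eq_intros simp: field_simps)
    show "continuous_on {\<bar>a - c\<bar>..a + c} (\<lambda>b. b / (2 * a * c))"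
      using pos by (intro continuous_intros) auto
  qed (use pos in auto)
  then show ?thesis unfolding g Let_def by simp
qed

text \<open>The integration is over y, the point at which the translation is evaluated, and not over
  z: this is the bound that makes a kernel operator act on locally integrable functions. For fixed
  |x| and |z| the weight turns \<kappa> into a multiple of a beta density in |y|, and the beta
  integral is finite because its exponents \<alpha> - 1/2 exceed -1.\<close>

lemma nn_integral_dunkl_W_bounded:
  assumes \<alpha>: "\<alpha> > -1/2"
  obtains C where "0 \<le> C"
    "\<And>x z. x \<noteq> 0 \<Longrightarrow> z \<noteq> 0 \<Longrightarrow> (\<integral>\<^sup>+y. ennreal \<bar>dunkl_W \<alpha> x y z\<bar> \<partial>dunkl_lborel \<alpha>) \<le> ennreal C"
proof -
  define B where "B = Beta (\<alpha> + 1/2) (\<alpha> + 1/2)"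
  have beta: "(\<integral>\<^sup>+u. ennreal ((u * (1 - u)) powr (\<alpha> - 1/2) * indicator {0..1} u) \<partial>lborel) = ennreal B"
  proof -
    have "((\<lambda>u::real. u powr (\<alpha> - 1/2) * (1 - u) powr (\<alpha> - 1/2)) has_integral B) {0..1}"
      using has_integral_Beta_real[of "\<alpha> + 1/2" "\<alpha> + 1/2"] \<alpha> by (simp add: B_def)
    then have "(\<integral>\<^sup>+u. ennreal (indicator {0..1} u * (u powr (\<alpha> - 1/2) * (1 - u) powr (\<alpha> - 1/2))) \<partial>lborel) = ennreal B"
      by (intro nn_integral_has_integral_lebesgue) auto
    then show ?thesis
      by (rule trans[rotated]) (auto intro!: nn_integral_cong simp: powr_mult indicator_def)
  qed
  define A where "A = inverse (2 powr (\<alpha> + 1) * Gamma (\<alpha> + 1))"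
  define D where "D = (Gamma (\<alpha> + 1))\<^sup>2 / (2 powr (\<alpha> - 1) * sqrt pi * Gamma (\<alpha> + 1/2)) * 4 powr (2 * \<alpha> - 1) * 2"
  have AD: "0 \<le> A" "0 \<le> D"
    using \<alpha> by (auto simp: A_def D_def intro!: divide_nonneg_nonneg mult_nonneg_nonneg Gamma_real_nonneg)
  have Bnn: "0 \<le> B" using \<alpha> by (simp add: B_def Beta_def Gamma_real_nonneg)
  show ?thesis
  proof
    \<comment> \<open>The 8 is the factor 4 of \<open>abs_dunkl_W_le\<close> times 2 for the two
      signs of y.\<close>
    show "0 \<le> 8 * A * D * B" using AD Bnn by simp
    fix x z :: real assume xz: "x \<noteq> 0" "z \<noteq> 0"
    define a c where "a = \<bar>x\<bar>" and "c = \<bar>z\<bar>"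
    have ac: "0 < a" "0 < c" using xz by (auto simp: a_def c_def)
    define E where "E b = (let u = (b\<^sup>2 - (a - c)\<^sup>2) / (4 * a * c) in
        (u * (1 - u)) powr (\<alpha> - 1/2) * (b / (2 * a * c))) * indicator {\<bar>a - c\<bar>..a + c} b" for b :: real
    have [measurable]: "E \<in> borel_measurable borel"
      unfolding E_def Let_def by measurable
    have Enn: "0 \<le> E b" for b
      using ac by (auto simp: E_def Let_def indicator_def)
    \<comment> \<open>As \<open>E\<close> is nonnegative, \<open>E y + E (- y)\<close> majorises
      \<open>E \<bar>y\<bar>\<close> for either sign of y, and both summands have the same
      integral.\<close>
    have key: "ennreal (dunkl_weight \<alpha> y) * ennreal \<bar>dunkl_W \<alpha> x y z\<bar>
        \<le> ennreal (4 * A * D) * (ennreal (E y) + ennreal (E (- y)))" for y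
    proof (cases "y = 0 \<or> \<bar>y\<bar> \<notin> {\<bar>a - c\<bar>..a + c}")
      case True
      moreover have "\<bar>z\<bar> \<in> {\<bar>\<bar>x\<bar> - \<bar>y\<bar>\<bar>..\<bar>x\<bar> + \<bar>y\<bar>} \<Longrightarrow> \<bar>y\<bar> \<in> {\<bar>a - c\<bar>..a + c}"
        unfolding a_def c_def atLeastAtMost_iff by (elim conjE, intro conjI; linarith)
      moreover have "dunkl_weight \<alpha> 0 = 0" by (simp add: dunkl_weight_def)
      ultimately have "dunkl_weight \<alpha> y = 0 \<or> \<bar>z\<bar> \<notin> {\<bar>\<bar>x\<bar> - \<bar>y\<bar>\<bar>..\<bar>x\<bar> + \<bar>y\<bar>}"
        by blast
      then have "dunkl_weight \<alpha> y = 0 \<or> dunkl_W \<alpha> x y z = 0"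
        by (elim disjE) (simp_all only: dunkl_W_def dunkl_kappa_def if_False mult_zero_right simp_thms)
      then show ?thesis by (elim disjE) simp_all
    next
      case False
      then have y: "0 < \<bar>y\<bar>" "\<bar>y\<bar> \<in> {\<bar>a - c\<bar>..a + c}" by auto
      have "dunkl_weight \<alpha> y * \<bar>dunkl_W \<alpha> x y z\<bar> \<le> dunkl_weight \<alpha> y * (4 * dunkl_kappa \<alpha> a \<bar>y\<bar> c)"
        unfolding a_def c_def using \<alpha>
        by (intro mult_left_mono abs_dunkl_W_le dunkl_weight_nonneg) simp_all
      also have "\<dots> = 4 * A * (dunkl_kappa \<alpha> a \<bar>y\<bar> c * \<bar>y\<bar> powr (2 * \<alpha> + 1))"
        unfolding dunkl_weight_def A_def by (simp only: mult_ac)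
      also have "\<dots> = 4 * A * (D * E \<bar>y\<bar>)"
        unfolding dunkl_kappa_weight[OF ac(1) y(1) ac(2) y(2)] D_def E_def Let_def
        by (simp only: indicator_simps(1)[OF y(2)] mult_1_right)
      also have "\<dots> \<le> 4 * A * D * (E y + E (- y))"
      proof -
        have "E \<bar>y\<bar> \<le> E y + E (- y)"
          using Enn[of y] Enn[of "- y"] by (cases "y \<ge> 0") simp_all
        then show ?thesis
          using AD unfolding mult.assoc by (intro mult_left_mono) simp_all
      qed
      finally have "ennreal (dunkl_weight \<alpha> y * \<bar>dunkl_W \<alpha> x y z\<bar>)
          \<le> ennreal (4 * A * D * (E y + E (- y)))"
        by (rule ennreal_leI)
      then show ?thesis
        using AD Enn \<alpha> by (simp only: ennreal_mult ennreal_plus dunkl_weight_nonneg abs_ge_zero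
            mult_nonneg_nonneg add_nonneg_nonneg zero_le_numeral)
    qed
    have int_E: "(\<integral>\<^sup>+y. ennreal (E y) \<partial>lborel) = ennreal B"
      unfolding E_def nn_integral_beta_substitution[OF ac] by (rule beta)
    have "(\<integral>\<^sup>+y. ennreal \<bar>dunkl_W \<alpha> x y z\<bar> \<partial>dunkl_lborel \<alpha>)
        = (\<integral>\<^sup>+y. ennreal (dunkl_weight \<alpha> y) * ennreal \<bar>dunkl_W \<alpha> x y z\<bar> \<partial>lborel)"
      unfolding dunkl_lborel_def by (subst nn_integral_density) auto
    also have "\<dots> \<le> (\<integral>\<^sup>+y. ennreal (4 * A * D) * (ennreal (E y) + ennreal (E (- y))) \<partial>lborel)"
      by (intro nn_integral_mono key)
    also have "\<dots> = ennreal (4 * A * D) * ((\<integral>\<^sup>+y. ennreal (E y) \<partial>lborel) + (\<integral>\<^sup>+y. ennreal (E (- y)) \<partial>lborel))"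
      by (simp add: nn_integral_cmult nn_integral_add)
    also have "(\<integral>\<^sup>+y. ennreal (E (- y)) \<partial>lborel) = (\<integral>\<^sup>+y. ennreal (E y) \<partial>lborel)"
      using nn_integral_real_affine[of "\<lambda>y. ennreal (E y)" "-1" 0] by simp
    also have "ennreal (4 * A * D) * ((\<integral>\<^sup>+y. ennreal (E y) \<partial>lborel) + (\<integral>\<^sup>+y. ennreal (E y) \<partial>lborel))
        = ennreal (8 * A * D * B)"
      unfolding int_E using AD Bnn by (simp flip: ennreal_mult ennreal_plus)
    finally show "(\<integral>\<^sup>+y. ennreal \<bar>dunkl_W \<alpha> x y z\<bar> \<partial>dunkl_lborel \<alpha>) \<le> ennreal (8 * A * D * B)" .
  qed
qed

section \<open>Translation and mean\<close>

lemma measurable_ball_real [measurable]: "ball (x::real) r \<in> sets borel"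
  by simp

lemma dunkl_translation_eq:
  assumes "\<alpha> > -1" and [measurable]: "f \<in> borel_measurable borel"
  shows "dunkl_translation \<alpha> x f y =
     (if \<alpha> = -1/2 then f (x + y) else if y = 0 then f x else if x = 0 then f y
      else (LINT z|dunkl_lborel \<alpha>. dunkl_W \<alpha> x y z *\<^sub>R f z))"
  unfolding dunkl_translation_def
  by (subst integral_dunkl_measure_AE_eq[OF assms(1) AE_I2[OF refl]]) simp_all

text \<open>The function itself may depend on the parameter. Applied to dilates this gives joint
  measurability in the dilation t and the point y, on which the later exchanges of integrals rest.
  The Dirac branches are evaluations of \<open>F\<close> along measurable curves; the kernel branch
  is an integral with parameters.\<close>

lemma measurable_dunkl_translation:
  assumes \<alpha>: "\<alpha> > -1" and F: "case_prod F \<in> borel_measurable (N \<Otimes>\<^sub>M borel)"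
    and [measurable]: "X \<in> borel_measurable N" "Y \<in> borel_measurable N"
  shows "(\<lambda>t. dunkl_translation \<alpha> (X t) (F t) (Y t)) \<in> borel_measurable N"
proof -
  have [measurable]: "(\<lambda>q. F (fst q) (snd q)) \<in> borel_measurable (N \<Otimes>\<^sub>M borel)"
    using F by (simp add: case_prod_beta')
  have ev: "(\<lambda>t. F t (g t)) \<in> borel_measurable N" if [measurable]: "g \<in> borel_measurable N" for g
  proof -
    have "(\<lambda>t. (t, g t)) \<in> N \<rightarrow>\<^sub>M N \<Otimes>\<^sub>M borel" by measurable
    from measurable_compose[OF this F] show ?thesis by simp
  qed
  have "(\<lambda>q. dunkl_W \<alpha> (X (fst q)) (Y (fst q)) (snd q) *\<^sub>R F (fst q) (snd q)) \<in> borel_measurable (N \<Otimes>\<^sub>M borel)"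
    by measurable
  then have "(\<lambda>q. dunkl_W \<alpha> (X (fst q)) (Y (fst q)) (snd q) *\<^sub>R F (fst q) (snd q)) \<in> borel_measurable (N \<Otimes>\<^sub>M dunkl_lborel \<alpha>)"
    by (simp cong: measurable_cong_sets sets_pair_measure_cong)
  then have "(\<lambda>t. LINT z|dunkl_lborel \<alpha>. dunkl_W \<alpha> (X t) (Y t) z *\<^sub>R F t z) \<in> borel_measurable N"
    by (intro dunkl.borel_measurable_lebesgue_integral) (simp add: case_prod_beta')
  moreover have "{t \<in> space N. Y t = 0} \<in> sets N" "{t \<in> space N. X t = 0} \<in> sets N"
    by measurable
  ultimately have "(\<lambda>t. if \<alpha> = -1/2 then F t (X t + Y t) else if Y t = 0 then F t (X t) else if X t = 0 then F t (Y t)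
      else (LINT z|dunkl_lborel \<alpha>. dunkl_W \<alpha> (X t) (Y t) z *\<^sub>R F t z)) \<in> borel_measurable N"
    by (intro measurable_If ev borel_measurable_add assms(3,4)) simp_all
  moreover have "dunkl_translation \<alpha> (X t) (F t) (Y t)
     = (if \<alpha> = -1/2 then F t (X t + Y t) else if Y t = 0 then F t (X t) else if X t = 0 then F t (Y t)
      else (LINT z|dunkl_lborel \<alpha>. dunkl_W \<alpha> (X t) (Y t) z *\<^sub>R F t z))" if "t \<in> space N" for t
  proof (rule dunkl_translation_eq[OF \<alpha>])
    show "F t \<in> borel_measurable borel"
      using measurable_compose_Pair1[OF that F] by simp
  qed
  ultimately show ?thesis
    by (subst measurable_cong) auto
qed

lemma measurable_dunkl_translation_const:
  assumes "\<alpha> > -1" "f \<in> borel_measurable borel"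
  shows "dunkl_translation \<alpha> x f \<in> borel_measurable borel"
proof -
  have "(\<lambda>q. f (snd q)) \<in> borel_measurable (borel \<Otimes>\<^sub>M borel)"
    using assms(2) by (rule measurable_compose[OF measurable_snd])
  then have "case_prod (\<lambda>_. f) \<in> borel_measurable (borel \<Otimes>\<^sub>M borel)"
    by (simp only: case_prod_beta')
  moreover have "(\<lambda>_::real. x) \<in> borel_measurable borel" "(\<lambda>y::real. y) \<in> borel_measurable borel"
    by measurable
  ultimately show ?thesis
    by (rule measurable_dunkl_translation[OF assms(1), where F = "\<lambda>_. f" and X = "\<lambda>_. x" and Y = "\<lambda>y. y"])
qed

lemma emeasure_dunkl_measure_ball: "emeasure (dunkl_measure \<alpha>) (ball 0 r) = emeasure (dunkl_lborel \<alpha>) (ball 0 r)"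
proof -
  have "(indicator (ball 0 r) :: real \<Rightarrow> ennreal) \<in> borel_measurable borel"
    by (intro borel_measurable_indicator measurable_ball_real)
  from nn_integral_dunkl_measure[OF this] show ?thesis by (simp add: nn_integral_indicator)
qed

lemma dunkl_mean_eq:
  assumes "\<alpha> > -1" "f \<in> borel_measurable borel"
  shows "dunkl_mean \<alpha> f r x = (LINT y|dunkl_lborel \<alpha>. indicator (ball 0 r) y *\<^sub>R dunkl_translation \<alpha> x f y)
    /\<^sub>R measure (dunkl_lborel \<alpha>) (ball 0 r)"
proof -
  have [measurable]: "dunkl_translation \<alpha> x f \<in> borel_measurable borel"
    using assms by (rule measurable_dunkl_translation_const)
  have "(LINT y|dunkl_measure \<alpha>. indicator (ball 0 r) y *\<^sub>R dunkl_translation \<alpha> x f y)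
      = (LINT y|dunkl_lborel \<alpha>. indicator (ball 0 r) y *\<^sub>R dunkl_translation \<alpha> x f y)"
  proof (rule integral_dunkl_measure_AE_eq[OF assms(1) AE_I2[OF refl]])
    show "(\<lambda>y. indicator (ball 0 r) y *\<^sub>R dunkl_translation \<alpha> x f y) \<in> borel_measurable borel"
      by measurable
  qed
  then show ?thesis
    by (simp only: dunkl_mean_def set_lebesgue_integral_def measure_def emeasure_dunkl_measure_ball)
qed

section \<open>Oscillation\<close>

text \<open>The p-th power of the oscillation, without the root and without division by the measure
  of the ball: a plain integral, to which scaling and Minkowski's inequality apply directly.\<close>

definition dunkl_osc :: "real \<Rightarrow> real \<Rightarrow> (real \<Rightarrow> complex) \<Rightarrow> real \<Rightarrow> real \<Rightarrow> ennreal" where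
  "dunkl_osc \<alpha> p f r x =
     (\<integral>\<^sup>+ y\<in>ball 0 r. ennreal (cmod (dunkl_translation \<alpha> x f y - dunkl_mean \<alpha> f r x) powr p) \<partial>dunkl_lborel \<alpha>)"

lemma powr_inverse_le_iff:
  fixes a b p :: real
  assumes "0 < p" "0 \<le> a" "0 \<le> b"
  shows "a powr (1 / p) \<le> b \<longleftrightarrow> a \<le> b powr p"
proof
  assume "a powr (1 / p) \<le> b"
  then have "(a powr (1 / p)) powr p \<le> b powr p"
    using assms by (intro powr_mono2) auto
  then show "a \<le> b powr p" using assms by (simp add: powr_powr)
next
  assume "a \<le> b powr p"
  then have "a powr (1 / p) \<le> (b powr p) powr (1 / p)"
    using assms by (intro powr_mono2) auto
  then show "a powr (1 / p) \<le> b" using assms by (simp add: powr_powr)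
qed

text \<open>Clears roots and quotients of extended numbers. The conversion is an equivalence because
  the measure of the ball is positive and finite and \<phi> is positive; an infinite oscillation
  violates both sides.\<close>

lemma campanato_norm_le_iff:
  assumes \<alpha>: "\<alpha> \<ge> -1/2" and p: "1 \<le> p" and \<phi>: "\<And>r. 0 < r \<Longrightarrow> 0 < \<phi> r"
    and f: "f \<in> borel_measurable borel" and N: "0 \<le> N"
  shows "campanato_norm \<alpha> p \<phi> f \<le> ennreal N \<longleftrightarrow>
    (\<forall>r>0. \<forall>x. dunkl_osc \<alpha> p f r x \<le> ennreal ((N * \<phi> r) powr p) * emeasure (dunkl_lborel \<alpha>) (ball 0 r))"
proof -
  have \<alpha>1: "\<alpha> > -1" using \<alpha> by simp
  have [measurable]: "dunkl_translation \<alpha> x f \<in> borel_measurable borel" for x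
    using \<alpha>1 f by (rule measurable_dunkl_translation_const)
  have "ennreal_power ((\<integral>\<^sup>+ y\<in>ball 0 r. ennreal (cmod (dunkl_translation \<alpha> x f y - dunkl_mean \<alpha> f r x) powr p)
             \<partial>dunkl_measure \<alpha>) / emeasure (dunkl_measure \<alpha>) (ball 0 r)) (1 / p) / ennreal (\<phi> r) \<le> ennreal N
      \<longleftrightarrow> dunkl_osc \<alpha> p f r x \<le> ennreal ((N * \<phi> r) powr p) * emeasure (dunkl_lborel \<alpha>) (ball 0 r)"
    if r: "0 < r" for r x
  proof -
    let ?O = "dunkl_osc \<alpha> p f r x" and ?m = "emeasure (dunkl_lborel \<alpha>) (ball 0 r)"
    obtain m where m: "?m = ennreal m" "0 < m"
      using emeasure_dunkl_ball_pos[OF \<alpha>1 r] emeasure_dunkl_ball_finite[OF \<alpha>, of r]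
      by (cases ?m) auto
    have "(\<integral>\<^sup>+ y\<in>ball 0 r. ennreal (cmod (dunkl_translation \<alpha> x f y - dunkl_mean \<alpha> f r x) powr p) \<partial>dunkl_measure \<alpha>) = ?O"
      unfolding dunkl_osc_def by (rule nn_integral_dunkl_measure) measurable
    moreover have "ennreal_power (?O / ?m) (1 / p) / ennreal (\<phi> r) \<le> ennreal N
        \<longleftrightarrow> ?O \<le> ennreal ((N * \<phi> r) powr p) * ?m"
    proof (cases ?O)
      case (real w)
      have "ennreal_power (?O / ?m) (1 / p) / ennreal (\<phi> r) = ennreal ((w / m) powr (1 / p) / \<phi> r)"
        unfolding m real using m(2) real(1) \<phi>[OF r] by (simp add: divide_ennreal ennreal_power_def)
      then have "ennreal_power (?O / ?m) (1 / p) / ennreal (\<phi> r) \<le> ennreal N \<longleftrightarrow> (w / m) powr (1 / p) \<le> N * \<phi> r"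
        using \<phi>[OF r] N by (simp add: pos_divide_le_eq)
      also have "\<dots> \<longleftrightarrow> w / m \<le> (N * \<phi> r) powr p"
        using p m(2) real(1) N \<phi>[OF r] by (intro powr_inverse_le_iff) auto
      also have "\<dots> \<longleftrightarrow> ?O \<le> ennreal ((N * \<phi> r) powr p) * ?m"
        unfolding m real using m(2) by (simp add: pos_divide_le_eq flip: ennreal_mult)
      finally show ?thesis .
    next
      case top
      have "\<not> ?O \<le> ennreal ((N * \<phi> r) powr p) * ?m"
        unfolding m top by (simp add: top_unique ennreal_mult_eq_top_iff)
      moreover have "ennreal_power (?O / ?m) (1 / p) / ennreal (\<phi> r) = \<infinity>"
        unfolding m top using \<phi>[OF r] by (simp add: ennreal_power_def ennreal_top_divide)
      ultimately show ?thesis by (simp add: top_unique)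
    qed
    ultimately show ?thesis by (simp add: emeasure_dunkl_measure_ball)
  qed
  then show ?thesis
    unfolding campanato_norm_def SUP_le_iff by auto
qed

section \<open>Behaviour of translation, mean and oscillation under dilations\<close>

lemma indicator_ball_scale:
  fixes t u :: real
  assumes "t \<noteq> 0"
  shows "indicator (ball 0 r) (t * u) = indicator (ball 0 (r / \<bar>t\<bar>)) u"
  using assms by (simp add: indicator_def abs_mult pos_less_divide_eq mult.commute)

lemma emeasure_dunkl_ball_scale:
  assumes "\<alpha> > -1" "t \<noteq> 0"
  shows "emeasure (dunkl_lborel \<alpha>) (ball 0 r)
    = ennreal (\<bar>t\<bar> powr dunkl_dim \<alpha>) * emeasure (dunkl_lborel \<alpha>) (ball 0 (r / \<bar>t\<bar>))"
proof -
  have "(indicator (ball 0 r) :: real \<Rightarrow> ennreal) \<in> borel_measurable borel"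
    by (intro borel_measurable_indicator measurable_ball_real)
  from nn_integral_dunkl_scale[OF this assms(2,1)] show ?thesis
    by (simp add: indicator_ball_scale[OF assms(2)])
qed

text \<open>In the substitution z -> t z the factor |t|^d of the measure cancels the factor |t|^(-d)
  of the kernel.\<close>

lemma dunkl_translation_scale:
  assumes \<alpha>: "\<alpha> > -1" and [measurable]: "f \<in> borel_measurable borel" and t: "t \<noteq> 0"
  shows "dunkl_translation \<alpha> x (\<lambda>z. f (z / t)) y = dunkl_translation \<alpha> (x / t) f (y / t)"
proof -
  have "(LINT z|dunkl_lborel \<alpha>. dunkl_W \<alpha> x y z *\<^sub>R f (z / t))
      = (LINT z|dunkl_lborel \<alpha>. dunkl_W \<alpha> (x / t) (y / t) z *\<^sub>R f z)"
  proof -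
    have W: "dunkl_W \<alpha> x y (t * z) = \<bar>t\<bar> powr (- dunkl_dim \<alpha>) * dunkl_W \<alpha> (x / t) (y / t) z" for z
      using dunkl_W_scale[OF t, of \<alpha> "x / t" "y / t" z] t by simp
    have "(LINT z|dunkl_lborel \<alpha>. dunkl_W \<alpha> x y z *\<^sub>R f (z / t))
        = \<bar>t\<bar> powr dunkl_dim \<alpha> *\<^sub>R (LINT z|dunkl_lborel \<alpha>. dunkl_W \<alpha> x y (t * z) *\<^sub>R f (t * z / t))"
      by (rule integral_dunkl_scale[OF _ t \<alpha>]) measurable
    also have "\<dots> = (LINT z|dunkl_lborel \<alpha>. dunkl_W \<alpha> (x / t) (y / t) z *\<^sub>R f z)"
      unfolding W using t by (simp add: powr_minus flip: scaleR_scaleR) simp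
    finally show ?thesis .
  qed
  then show ?thesis
    using t \<alpha> by (subst (1 2) dunkl_translation_eq) (auto simp: add_divide_distrib)
qed

lemma dunkl_mean_scale:
  assumes \<alpha>: "\<alpha> > -1" and [measurable]: "f \<in> borel_measurable borel" and t: "t \<noteq> 0"
  shows "dunkl_mean \<alpha> (\<lambda>z. f (z / t)) r x = dunkl_mean \<alpha> f (r / \<bar>t\<bar>) (x / t)"
proof -
  have T: "dunkl_translation \<alpha> x (\<lambda>z. f (z / t)) (t * y) = dunkl_translation \<alpha> (x / t) f y" for y
    using dunkl_translation_scale[OF \<alpha> assms(2) t, of x "t * y"] t by simp
  have [measurable]: "dunkl_translation \<alpha> x (\<lambda>z. f (z / t)) \<in> borel_measurable borel"
    by (rule measurable_dunkl_translation_const[OF \<alpha>]) measurable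
  have "(LINT y|dunkl_lborel \<alpha>. indicator (ball 0 r) y *\<^sub>R dunkl_translation \<alpha> x (\<lambda>z. f (z / t)) y)
     = \<bar>t\<bar> powr dunkl_dim \<alpha> *\<^sub>R (LINT y|dunkl_lborel \<alpha>. indicator (ball 0 r) (t * y) *\<^sub>R dunkl_translation \<alpha> x (\<lambda>z. f (z / t)) (t * y))"
    by (rule integral_dunkl_scale[OF _ t \<alpha>]) measurable
  also have "\<dots> = \<bar>t\<bar> powr dunkl_dim \<alpha> *\<^sub>R (LINT y|dunkl_lborel \<alpha>. indicator (ball 0 (r / \<bar>t\<bar>)) y *\<^sub>R dunkl_translation \<alpha> (x / t) f y)"
    unfolding T indicator_ball_scale[OF t] ..
  finally have 1: "(LINT y|dunkl_lborel \<alpha>. indicator (ball 0 r) y *\<^sub>R dunkl_translation \<alpha> x (\<lambda>z. f (z / t)) y)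
    = \<bar>t\<bar> powr dunkl_dim \<alpha> *\<^sub>R (LINT y|dunkl_lborel \<alpha>. indicator (ball 0 (r / \<bar>t\<bar>)) y *\<^sub>R dunkl_translation \<alpha> (x / t) f y)" .
  have 2: "measure (dunkl_lborel \<alpha>) (ball 0 r)
     = \<bar>t\<bar> powr dunkl_dim \<alpha> * measure (dunkl_lborel \<alpha>) (ball 0 (r / \<bar>t\<bar>))"
    unfolding measure_def by (subst emeasure_dunkl_ball_scale[OF \<alpha> t]) (simp add: enn2real_mult)
  show ?thesis
    using t \<alpha> by (subst (1 2) dunkl_mean_eq) (simp_all add: 1 2)
qed

lemma dunkl_osc_scale:
  assumes \<alpha>: "\<alpha> > -1" and [measurable]: "f \<in> borel_measurable borel" and t: "t \<noteq> 0"
  shows "dunkl_osc \<alpha> p (\<lambda>z. f (z / t)) r x = ennreal (\<bar>t\<bar> powr dunkl_dim \<alpha>) * dunkl_osc \<alpha> p f (r / \<bar>t\<bar>) (x / t)"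
proof -
  have T: "dunkl_translation \<alpha> x (\<lambda>z. f (z / t)) (t * y) = dunkl_translation \<alpha> (x / t) f y" for y
    using dunkl_translation_scale[OF \<alpha> assms(2) t, of x "t * y"] t by simp
  have [measurable]: "dunkl_translation \<alpha> x (\<lambda>z. f (z / t)) \<in> borel_measurable borel"
    by (rule measurable_dunkl_translation_const[OF \<alpha>]) measurable
  show ?thesis
    unfolding dunkl_osc_def
    by (subst nn_integral_dunkl_scale[OF _ t \<alpha>])
       (simp_all add: T dunkl_mean_scale[OF \<alpha> assms(2) t] indicator_ball_scale[OF t])
qed

text \<open>The change of centre from x to x / t is absorbed by the supremum over all centres, and
  the factor |t|^d of the oscillation is the one that turns the measure of the small ball into that
  of \<open>ball 0 r\<close>.\<close>

lemma dunkl_osc_dilation_le: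
  assumes \<alpha>: "\<alpha> \<ge> -1/2" and p: "1 \<le> p" and \<phi>: "\<And>r. 0 < r \<Longrightarrow> 0 < \<phi> r"
    and f: "f \<in> borel_measurable borel" and N: "0 \<le> N" "campanato_norm \<alpha> p \<phi> f \<le> ennreal N"
    and r: "0 < r" and t: "t \<noteq> 0"
  shows "dunkl_osc \<alpha> p (\<lambda>z. f (z / t)) r x
     \<le> ennreal ((N * \<phi> (r / \<bar>t\<bar>)) powr p) * emeasure (dunkl_lborel \<alpha>) (ball 0 r)"
proof -
  have \<alpha>1: "\<alpha> > -1" using \<alpha> by simp
  have "dunkl_osc \<alpha> p f (r / \<bar>t\<bar>) (x / t)
      \<le> ennreal ((N * \<phi> (r / \<bar>t\<bar>)) powr p) * emeasure (dunkl_lborel \<alpha>) (ball 0 (r / \<bar>t\<bar>))"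
    using campanato_norm_le_iff[of \<alpha> p \<phi> f N] assms by simp
  then have "ennreal (\<bar>t\<bar> powr dunkl_dim \<alpha>) * dunkl_osc \<alpha> p f (r / \<bar>t\<bar>) (x / t)
      \<le> ennreal (\<bar>t\<bar> powr dunkl_dim \<alpha>) * (ennreal ((N * \<phi> (r / \<bar>t\<bar>)) powr p) * emeasure (dunkl_lborel \<alpha>) (ball 0 (r / \<bar>t\<bar>)))"
    by (rule mult_left_mono) simp
  then show ?thesis
    unfolding dunkl_osc_scale[OF \<alpha>1 f t] emeasure_dunkl_ball_scale[OF \<alpha>1 t, of r] by (simp add: mult_ac)
qed

section \<open>Independence of the representative\<close>

text \<open>The kernel branch ignores null sets for each y, but the shift and the branch x = 0 are
  point evaluations in y, and y = 0 returns the value at x. Hence only almost every y can be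
  claimed.\<close>

lemma dunkl_translation_cong_AE:
  assumes \<alpha>: "\<alpha> > -1" and fg: "AE x in lebesgue. f x = g x" and g: "g \<in> borel_measurable borel"
  shows "AE y in lebesgue. dunkl_translation \<alpha> x f y = dunkl_translation \<alpha> x g y"
proof -
  have "(LINT z|dunkl_measure \<alpha>. dunkl_W \<alpha> x y z *\<^sub>R f z) = (LINT z|dunkl_measure \<alpha>. dunkl_W \<alpha> x y z *\<^sub>R g z)" for y
  proof -
    have "AE z in lebesgue. dunkl_W \<alpha> x y z *\<^sub>R f z = dunkl_W \<alpha> x y z *\<^sub>R g z"
      using fg by eventually_elim simp
    moreover have [measurable]: "g \<in> borel_measurable borel" by (rule g)
    ultimately have "(LINT z|dunkl_measure \<alpha>. dunkl_W \<alpha> x y z *\<^sub>R f z) = (LINT z|dunkl_lborel \<alpha>. dunkl_W \<alpha> x y z *\<^sub>R g z)"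
      by (intro integral_dunkl_measure_AE_eq[OF \<alpha>]) simp_all
    also have "\<dots> = (LINT z|dunkl_measure \<alpha>. dunkl_W \<alpha> x y z *\<^sub>R g z)"
      by (intro integral_dunkl_measure_AE_eq[OF \<alpha>, symmetric]) simp_all
    finally show ?thesis .
  qed
  note W = this
  show ?thesis
    using AE_lebesgue_plus[OF fg, of x] fg AE_lebesgue_neq[of 0]
    by eventually_elim (simp add: dunkl_translation_def W)
qed

text \<open>Integrating over y removes the exceptional points, so the means agree for every x. This
  is essential because the norm takes a supremum, not an essential supremum, over x.\<close>

lemma dunkl_mean_cong_AE:
  assumes \<alpha>: "\<alpha> > -1" and fg: "AE x in lebesgue. f x = g x" and g: "g \<in> borel_measurable borel"
  shows "dunkl_mean \<alpha> f r x = dunkl_mean \<alpha> g r x"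
proof -
  have [measurable]: "dunkl_translation \<alpha> x g \<in> borel_measurable borel"
    using \<alpha> g by (rule measurable_dunkl_translation_const)
  have "AE y in lebesgue. indicator (ball 0 r) y *\<^sub>R dunkl_translation \<alpha> x f y
      = indicator (ball 0 r) y *\<^sub>R dunkl_translation \<alpha> x g y"
    using dunkl_translation_cong_AE[OF assms, of x] by eventually_elim simp
  then have "(LINT y|dunkl_measure \<alpha>. indicator (ball 0 r) y *\<^sub>R dunkl_translation \<alpha> x f y)
      = (LINT y|dunkl_lborel \<alpha>. indicator (ball 0 r) y *\<^sub>R dunkl_translation \<alpha> x g y)"
  proof (rule integral_dunkl_measure_AE_eq[OF \<alpha>])
    show "(\<lambda>y. indicator (ball 0 r) y *\<^sub>R dunkl_translation \<alpha> x g y) \<in> borel_measurable borel"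
      by measurable
  qed
  then show ?thesis
    by (simp only: dunkl_mean_eq[OF \<alpha> g] dunkl_mean_def[of \<alpha> f] set_lebesgue_integral_def measure_def
      emeasure_dunkl_measure_ball)
qed

lemma campanato_norm_cong_AE:
  assumes \<alpha>: "\<alpha> > -1" and fg: "AE x in lebesgue. f x = g x" and g: "g \<in> borel_measurable borel"
  shows "campanato_norm \<alpha> p \<phi> f = campanato_norm \<alpha> p \<phi> g"
proof -
  have "(\<integral>\<^sup>+ y\<in>ball 0 r. ennreal (cmod (dunkl_translation \<alpha> x f y - dunkl_mean \<alpha> f r x) powr p) \<partial>dunkl_measure \<alpha>)
      = (\<integral>\<^sup>+ y\<in>ball 0 r. ennreal (cmod (dunkl_translation \<alpha> x g y - dunkl_mean \<alpha> g r x) powr p) \<partial>dunkl_measure \<alpha>)" for r x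
  proof (rule nn_integral_cong_AE, subst AE_dunkl_iff(2)[OF \<alpha>])
    show "AE y in lebesgue. ennreal (cmod (dunkl_translation \<alpha> x f y - dunkl_mean \<alpha> f r x) powr p) * indicator (ball 0 r) y
       = ennreal (cmod (dunkl_translation \<alpha> x g y - dunkl_mean \<alpha> g r x) powr p) * indicator (ball 0 r) y"
      using dunkl_translation_cong_AE[OF assms, of x]
      by eventually_elim (simp add: dunkl_mean_cong_AE[OF assms])
  qed
  then show ?thesis unfolding campanato_norm_def by simp
qed

lemma campanato_norm_0:
  assumes "\<alpha> \<ge> -1/2" "1 \<le> p" "\<And>r. 0 < r \<Longrightarrow> 0 < \<phi> r"
  shows "campanato_norm \<alpha> p \<phi> (\<lambda>_. 0) = 0"
proof -
  have T: "dunkl_translation \<alpha> x (\<lambda>_. 0) y = 0" for x y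
    by (simp add: dunkl_translation_def)
  have "dunkl_mean \<alpha> (\<lambda>_. 0) r x = 0" for r x
    by (simp add: dunkl_mean_def T set_lebesgue_integral_def)
  then have "dunkl_osc \<alpha> p (\<lambda>_. 0) r x = 0" for r x
    using assms(2) by (simp add: dunkl_osc_def T)
  then have "campanato_norm \<alpha> p \<phi> (\<lambda>_. 0) \<le> ennreal 0"
    using assms by (subst campanato_norm_le_iff) auto
  then show ?thesis by simp
qed

section \<open>The Hausdorff operator on Borel functions\<close>

text \<open>The last assumption provides the weight in \<open>weighted_minkowski\<close>; \<open>t \<mapsto> \<phi> (r / \<bar>t\<bar>)\<close> itself
  need not be Borel, and at \<open>t = 0\<close> it need not be positive.\<close>

locale campanato_hausdorff =
  fixes \<alpha> p N K :: real and \<phi> :: "real \<Rightarrow> real" and k f :: "real \<Rightarrow> complex"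
  assumes alpha: "\<alpha> \<ge> -1/2" and p: "1 \<le> p" and phi_pos: "\<And>r. 0 < r \<Longrightarrow> 0 < \<phi> r"
    and k_borel [measurable]: "k \<in> borel_measurable borel"
    and f_borel [measurable]: "f \<in> borel_measurable borel"
    and N: "0 \<le> N" "campanato_norm \<alpha> p \<phi> f \<le> ennreal N"
    and K: "0 \<le> K" "\<And>r. 0 < r \<Longrightarrow> (\<integral>\<^sup>+t. ennreal (cmod (k t) * \<phi> (r / \<bar>t\<bar>)) \<partial>lborel) \<le> ennreal (K * \<phi> r)"
    and phi_borel: "\<And>r. 0 < r \<Longrightarrow> \<exists>n\<in>borel_measurable borel. (\<forall>t. 0 < n t) \<and> (AE t in lborel. n t = \<phi> (r / \<bar>t\<bar>))"
begin

text \<open>\<open>k\<close> stands for \<psi> t / |t|^d, so this is the Hausdorff operator for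
  Borel data, with the same default value 0 where the integral does not converge absolutely.\<close>

definition h :: "real \<Rightarrow> complex" where
  "h z = (LINT t|lborel. k t * f (z / t))"

definition trans_dil :: "real \<Rightarrow> real \<Rightarrow> real \<Rightarrow> complex" where
  "trans_dil x t y = dunkl_translation \<alpha> x (\<lambda>z. f (z / t)) y"

definition mean_dil :: "real \<Rightarrow> real \<Rightarrow> real \<Rightarrow> complex" where
  "mean_dil r x t = dunkl_mean \<alpha> (\<lambda>z. f (z / t)) r x"

lemma alpha': "\<alpha> > -1"
  using alpha by simp

lemma measurable_trans_dil_pair [measurable]:
  "(\<lambda>q. trans_dil x (fst q) (snd q)) \<in> borel_measurable (lborel \<Otimes>\<^sub>M dunkl_lborel \<alpha>)"
proof -
  have "(\<lambda>q. dunkl_translation \<alpha> x (\<lambda>z. f (z / fst q)) (snd q)) \<in> borel_measurable (borel \<Otimes>\<^sub>M (borel :: real measure))"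
  proof (rule measurable_dunkl_translation[OF alpha', where X = "\<lambda>_. x" and Y = snd and F = "\<lambda>q z. f (z / fst q)"])
    show "(\<lambda>(q, z). f (z / fst q)) \<in> borel_measurable ((borel \<Otimes>\<^sub>M (borel :: real measure)) \<Otimes>\<^sub>M borel)"
      by measurable
  qed measurable
  then show ?thesis
    unfolding trans_dil_def by (simp cong: measurable_cong_sets sets_pair_measure_cong)
qed

lemma measurable_trans_dil [measurable]: "trans_dil x t \<in> borel_measurable (dunkl_lborel \<alpha>)"
  using measurable_compose_Pair1[OF _ measurable_trans_dil_pair[of x], of t] by simp

lemma mean_dil_eq:
  "mean_dil r x t = (LINT y|dunkl_lborel \<alpha>. indicator (ball 0 r) y *\<^sub>R trans_dil x t y)
     /\<^sub>R measure (dunkl_lborel \<alpha>) (ball 0 r)"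
  unfolding mean_dil_def trans_dil_def by (rule dunkl_mean_eq[OF alpha']) measurable

lemma measurable_mean_dil [measurable]: "mean_dil r x \<in> borel_measurable lborel"
proof -
  have "(\<lambda>q. indicator (ball 0 r) (snd q) *\<^sub>R trans_dil x (fst q) (snd q)) \<in> borel_measurable (lborel \<Otimes>\<^sub>M dunkl_lborel \<alpha>)"
    by measurable
  then have "(\<lambda>t. LINT y|dunkl_lborel \<alpha>. indicator (ball 0 r) y *\<^sub>R trans_dil x t y) \<in> borel_measurable lborel"
    by (intro dunkl.borel_measurable_lebesgue_integral) (simp add: case_prod_beta')
  then show ?thesis
    unfolding mean_dil_eq[abs_def] by measurable
qed

lemma measurable_h [measurable]: "h \<in> borel_measurable borel"
  unfolding h_def by measurable

text \<open>Minkowski's inequality with the weight n t = \<phi> (r / |t|): the mass of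
  \<open>k n\<close> is at most \<open>K * \<phi> r\<close>, and the oscillation of the dilate is
  governed by \<open>N * n t\<close>. Only the deviations of the dilates enter, so the bound holds
  whether or not the integral defining \<open>h\<close> converges.\<close>

lemma osc_dil_le:
  assumes r: "0 < r"
  shows "(\<integral>\<^sup>+y. ennreal_power (\<integral>\<^sup>+t. ennreal (cmod (k t) * (indicator (ball 0 r) y * cmod (trans_dil x t y - mean_dil r x t))) \<partial>lborel) p
      \<partial>dunkl_lborel \<alpha>) \<le> ennreal ((N * K * \<phi> r) powr p) * emeasure (dunkl_lborel \<alpha>) (ball 0 r)"
proof -
  obtain n where [measurable]: "n \<in> borel_measurable borel" and n: "\<And>t. 0 < n t"
    and n_eq: "AE t in lborel. n t = \<phi> (r / \<bar>t\<bar>)"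
    using phi_borel[OF r] by blast
  let ?m = "emeasure (dunkl_lborel \<alpha>) (ball 0 r)"
  let ?g = "\<lambda>t y. indicator (ball 0 r) y * cmod (trans_dil x t y - mean_dil r x t)"
  have "(\<integral>\<^sup>+t. ennreal (cmod (k t) * n t) \<partial>lborel) = (\<integral>\<^sup>+t. ennreal (cmod (k t) * \<phi> (r / \<bar>t\<bar>)) \<partial>lborel)"
    by (rule nn_integral_cong_AE) (use n_eq in eventually_elim, simp)
  also have "\<dots> \<le> ennreal (K * \<phi> r)" by (rule K(2)[OF r])
  finally have S_le: "(\<integral>\<^sup>+t. ennreal (cmod (k t) * n t) \<partial>lborel) \<le> ennreal (K * \<phi> r)" .
  then obtain S where S: "(\<integral>\<^sup>+t. ennreal (cmod (k t) * n t) \<partial>lborel) = ennreal S" "0 \<le> S"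
    by (cases "\<integral>\<^sup>+t. ennreal (cmod (k t) * n t) \<partial>lborel") (auto simp: top_unique)
  have S_K: "S \<le> K * \<phi> r" using S_le S K(1) phi_pos[OF r] by (simp add: ennreal_le_iff)
  have "(\<integral>\<^sup>+y. ennreal_power (\<integral>\<^sup>+t. ennreal (cmod (k t) * ?g t y) \<partial>lborel) p \<partial>dunkl_lborel \<alpha>)
      \<le> ennreal (S powr p) * (ennreal (N powr p) * ?m)"
  proof (rule lborel_dunkl.weighted_minkowski[where n = n, OF _ _ _ _ _ n p S])
    have "(\<lambda>q. indicator (ball 0 r) (snd q) * cmod (trans_dil x (fst q) (snd q) - mean_dil r x (fst q)))
        \<in> borel_measurable (lborel \<Otimes>\<^sub>M dunkl_lborel \<alpha>)"
      by measurable
    then show "(\<lambda>(t, y). ?g t y) \<in> borel_measurable (lborel \<Otimes>\<^sub>M dunkl_lborel \<alpha>)"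
      by (simp add: case_prod_beta')
    show "AE t in lborel. (\<integral>\<^sup>+y. ennreal (?g t y powr p) \<partial>dunkl_lborel \<alpha>)
        \<le> ennreal (n t powr p) * (ennreal (N powr p) * ?m)"
      using n_eq AE_lborel_singleton[of 0]
    proof eventually_elim
      fix t :: real assume nt: "n t = \<phi> (r / \<bar>t\<bar>)" and t: "t \<noteq> 0"
      have "(\<integral>\<^sup>+y. ennreal (?g t y powr p) \<partial>dunkl_lborel \<alpha>) = dunkl_osc \<alpha> p (\<lambda>z. f (z / t)) r x"
        unfolding dunkl_osc_def trans_dil_def mean_dil_def using p
        by (intro nn_integral_cong) (auto simp: indicator_def)
      also have "\<dots> \<le> ennreal ((N * \<phi> (r / \<bar>t\<bar>)) powr p) * ?m"
        using dunkl_osc_dilation_le[OF alpha p phi_pos f_borel N r t] .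
      also have "\<dots> = ennreal (n t powr p) * (ennreal (N powr p) * ?m)"
        using N(1) n[of t] by (simp add: nt powr_mult ennreal_mult mult_ac)
      finally show "(\<integral>\<^sup>+y. ennreal (?g t y powr p) \<partial>dunkl_lborel \<alpha>)
        \<le> ennreal (n t powr p) * (ennreal (N powr p) * ?m)" .
    qed
  qed auto
  also have "\<dots> = ennreal ((N * S) powr p) * ?m"
    using N(1) S(2) by (simp add: powr_mult ennreal_mult mult_ac)
  also have "\<dots> \<le> ennreal ((N * K * \<phi> r) powr p) * ?m"
    using S_K S(2) N(1) p by (intro mult_right_mono ennreal_leI powr_mono2) (auto simp: mult.assoc mult_left_mono)
  finally show ?thesis .
qed

lemma ennreal_le_1_plus_power: "X \<le> 1 + ennreal_power X p"
proof (cases X)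
  case (real u)
  have "u \<le> 1 + u powr p"
  proof (cases "u \<le> 1")
    case False
    then have "u powr 1 \<le> u powr p" using p by (intro powr_mono) auto
    then show ?thesis using False by simp
  qed (use powr_ge_zero[of u p] in linarith)
  then have "ennreal u \<le> ennreal (1 + u powr p)" by (rule ennreal_leI)
  then show ?thesis using real by (simp add: ennreal_power_def ennreal_plus)
qed (simp add: ennreal_power_def)

lemma measurable_osc_dil [measurable]:
  "(\<lambda>y. \<integral>\<^sup>+t. ennreal (cmod (k t) * (indicator (ball 0 r) y * cmod (trans_dil x t y - mean_dil r x t))) \<partial>lborel)
     \<in> borel_measurable (dunkl_lborel \<alpha>)"
proof -
  have "(\<lambda>q. ennreal (cmod (k (fst q)) * (indicator (ball 0 r) (snd q) * cmod (trans_dil x (fst q) (snd q) - mean_dil r x (fst q)))))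
      \<in> borel_measurable (lborel \<Otimes>\<^sub>M dunkl_lborel \<alpha>)"
    by measurable
  from measurable_pair_swap[OF this]
  show ?thesis
    by (intro lborel.borel_measurable_nn_integral) (simp add: case_prod_beta')
qed

text \<open>On a ball of finite measure an L^p bound implies an L^1 bound; the inequality X \<le> 1
  + X^p takes the place of Hoelder's.\<close>

lemma osc_dil_finite:
  assumes r: "0 < r"
  shows "(\<integral>\<^sup>+y. (\<integral>\<^sup>+t. ennreal (cmod (k t) * (indicator (ball 0 r) y * cmod (trans_dil x t y - mean_dil r x t))) \<partial>lborel)
      \<partial>dunkl_lborel \<alpha>) < \<infinity>"
proof -
  let ?X = "\<lambda>y. \<integral>\<^sup>+t. ennreal (cmod (k t) * (indicator (ball 0 r) y * cmod (trans_dil x t y - mean_dil r x t))) \<partial>lborel"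
  have "(\<integral>\<^sup>+y. ?X y \<partial>dunkl_lborel \<alpha>) \<le> (\<integral>\<^sup>+y. indicator (ball 0 r) y + ennreal_power (?X y) p \<partial>dunkl_lborel \<alpha>)"
  proof (rule nn_integral_mono)
    fix y show "?X y \<le> indicator (ball 0 r) y + ennreal_power (?X y) p"
      using ennreal_le_1_plus_power[of "?X y"] by (cases "y \<in> ball 0 r") auto
  qed
  also have "\<dots> = emeasure (dunkl_lborel \<alpha>) (ball 0 r) + (\<integral>\<^sup>+y. ennreal_power (?X y) p \<partial>dunkl_lborel \<alpha>)"
    by (subst nn_integral_add) auto
  also have "\<dots> < \<infinity>"
  proof -
    have "(\<integral>\<^sup>+y. ennreal_power (?X y) p \<partial>dunkl_lborel \<alpha>) < \<infinity>"
      using osc_dil_le[OF r, of x] emeasure_dunkl_ball_finite[OF alpha, of r]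
      by (auto intro: order_le_less_trans simp: ennreal_mult_less_top)
    then show ?thesis using emeasure_dunkl_ball_finite[OF alpha, of r] by simp
  qed
  finally show ?thesis .
qed

section \<open>Absolute convergence of the defining integral\<close>

lemma trans_dil_0: "y \<noteq> 0 \<Longrightarrow> trans_dil 0 t y = f (y / t)"
  by (simp add: trans_dil_def dunkl_translation_def)

definition absint :: "real \<Rightarrow> ennreal" where
  "absint z = (\<integral>\<^sup>+t. ennreal (cmod (k t) * cmod (f (z / t))) \<partial>lborel)"

lemma measurable_absint [measurable]: "absint \<in> borel_measurable borel"
  unfolding absint_def by measurable

text \<open>Centre 0 is used because the translation there is the identity off the origin. Let A be
  the integral of the means and D z that of the deviations, both against |k|. By the triangle
  inequality absint \<le> D + A and A \<le> D + absint on the ball, while D is integrable and hence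
  finite almost everywhere. The number A therefore decides which alternative holds on the
  ball.\<close>

lemma absint_dichotomy:
  obtains "\<And>r. 0 < r \<Longrightarrow> (\<integral>\<^sup>+z. absint z * indicator (ball 0 r) z \<partial>dunkl_lborel \<alpha>) < \<infinity>"
  | "AE z in lebesgue. absint z = \<infinity>"
proof -
  define A where "A r = (\<integral>\<^sup>+t. ennreal (cmod (k t) * cmod (mean_dil r 0 t)) \<partial>lborel)" for r
  define D where "D r z = (\<integral>\<^sup>+t. ennreal (cmod (k t) * (indicator (ball 0 r) z * cmod (trans_dil 0 t z - mean_dil r 0 t))) \<partial>lborel)" for r z
  have [measurable]: "D r \<in> borel_measurable (dunkl_lborel \<alpha>)" for r
    unfolding D_def by (rule measurable_osc_dil)
  have D_alt: "D r z = (\<integral>\<^sup>+t. ennreal (cmod (k t) * cmod (f (z / t) - mean_dil r 0 t)) \<partial>lborel)"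
    if "z \<noteq> 0" "z \<in> ball 0 r" for r z
    unfolding D_def using that by (simp add: trans_dil_0)
  have D_fin: "(\<integral>\<^sup>+z. D r z \<partial>dunkl_lborel \<alpha>) < \<infinity>" if "0 < r" for r
    unfolding D_def using that by (rule osc_dil_finite)
  have D_AE: "AE z in lebesgue. D r z \<noteq> \<infinity>" if "0 < r" for r
    using nn_integral_PInf_AE[of "D r" "dunkl_lborel \<alpha>"] D_fin[OF that] AE_dunkl_iff(1)[OF alpha', of "\<lambda>z. D r z \<noteq> \<infinity>"]
    by auto
  have absint_le: "absint z \<le> D r z + A r" if z: "z \<noteq> 0" "z \<in> ball 0 r" for r z
  proof -
    have "absint z \<le> (\<integral>\<^sup>+t. ennreal (cmod (k t) * cmod (f (z / t) - mean_dil r 0 t)) + ennreal (cmod (k t) * cmod (mean_dil r 0 t)) \<partial>lborel)"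
      unfolding absint_def
    proof (rule nn_integral_mono)
      fix t
      have "cmod (f (z / t)) \<le> cmod (f (z / t) - mean_dil r 0 t) + cmod (mean_dil r 0 t)"
        using norm_triangle_ineq[of "f (z / t) - mean_dil r 0 t" "mean_dil r 0 t"] by simp
      then have "cmod (k t) * cmod (f (z / t)) \<le> cmod (k t) * cmod (f (z / t) - mean_dil r 0 t) + cmod (k t) * cmod (mean_dil r 0 t)"
        by (simp add: mult_left_mono flip: distrib_left)
      then show "ennreal (cmod (k t) * cmod (f (z / t))) \<le> ennreal (cmod (k t) * cmod (f (z / t) - mean_dil r 0 t)) + ennreal (cmod (k t) * cmod (mean_dil r 0 t))"
        by (simp add: ennreal_leI flip: ennreal_plus)
    qed
    also have "\<dots> = D r z + A r"
      unfolding D_alt[OF z] A_def by (rule nn_integral_add) measurable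
    finally show ?thesis .
  qed
  have A_le: "A r \<le> D r z + absint z" if z: "z \<noteq> 0" "z \<in> ball 0 r" for r z
  proof -
    have "A r \<le> (\<integral>\<^sup>+t. ennreal (cmod (k t) * cmod (f (z / t) - mean_dil r 0 t)) + ennreal (cmod (k t) * cmod (f (z / t))) \<partial>lborel)"
      unfolding A_def
    proof (rule nn_integral_mono)
      fix t
      have "cmod (mean_dil r 0 t) \<le> cmod (f (z / t) - mean_dil r 0 t) + cmod (f (z / t))"
        using norm_triangle_ineq4[of "f (z / t)" "f (z / t) - mean_dil r 0 t"] by simp
      then have "cmod (k t) * cmod (mean_dil r 0 t) \<le> cmod (k t) * cmod (f (z / t) - mean_dil r 0 t) + cmod (k t) * cmod (f (z / t))"
        by (simp add: mult_left_mono flip: distrib_left)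
      then show "ennreal (cmod (k t) * cmod (mean_dil r 0 t)) \<le> ennreal (cmod (k t) * cmod (f (z / t) - mean_dil r 0 t)) + ennreal (cmod (k t) * cmod (f (z / t)))"
        by (simp add: ennreal_leI flip: ennreal_plus)
    qed
    also have "\<dots> = D r z + absint z"
      unfolding D_alt[OF z] absint_def by (rule nn_integral_add) measurable
    finally show ?thesis .
  qed
  have good: "(\<integral>\<^sup>+z. absint z * indicator (ball 0 r) z \<partial>dunkl_lborel \<alpha>) < \<infinity>"
    if r: "0 < r" and A: "A r < \<infinity>" for r
  proof -
    have "(\<integral>\<^sup>+z. absint z * indicator (ball 0 r) z \<partial>dunkl_lborel \<alpha>) \<le> (\<integral>\<^sup>+z. D r z + A r * indicator (ball 0 r) z \<partial>dunkl_lborel \<alpha>)"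
    proof (rule nn_integral_mono_AE)
      have "AE z in dunkl_lborel \<alpha>. z \<noteq> 0"
        unfolding AE_dunkl_iff(1)[OF alpha'] by (rule AE_lebesgue_neq)
      then show "AE z in dunkl_lborel \<alpha>. absint z * indicator (ball 0 r) z \<le> D r z + A r * indicator (ball 0 r) z"
      proof eventually_elim
        fix z :: real assume "z \<noteq> 0"
        then show "absint z * indicator (ball 0 r) z \<le> D r z + A r * indicator (ball 0 r) z"
          using absint_le[of z r] by (cases "z \<in> ball 0 r") auto
      qed
    qed
    also have "\<dots> = (\<integral>\<^sup>+z. D r z \<partial>dunkl_lborel \<alpha>) + A r * emeasure (dunkl_lborel \<alpha>) (ball 0 r)"
      by (subst nn_integral_add) (auto simp: nn_integral_cmult_indicator)
    also have "\<dots> < \<infinity>"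
      using D_fin[OF r] A emeasure_dunkl_ball_finite[OF alpha, of r] by (simp add: ennreal_mult_less_top)
    finally show ?thesis .
  qed
  have bad: "AE z in lebesgue. z \<in> ball 0 r \<longrightarrow> absint z = \<infinity>" if r: "0 < r" and A: "A r = \<infinity>" for r
    using D_AE[OF r] AE_lebesgue_neq[of 0]
  proof eventually_elim
    fix z :: real assume "D r z \<noteq> \<infinity>" "z \<noteq> 0"
    then show "z \<in> ball 0 r \<longrightarrow> absint z = \<infinity>"
      using A_le[of z r] A by (auto simp: top_unique)
  qed
  show ?thesis
  proof (cases "\<forall>r>0. A r < \<infinity>")
    case True
    then show ?thesis using good that(1) by blast
  next
    case False
    then obtain s where s: "0 < s" "A s = \<infinity>" by (auto simp: not_less top_unique)
    \<comment> \<open>Different radii cannot disagree: on the smaller of the two balls, which has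
      positive measure, \<open>absint\<close> would be finite and infinite almost
      everywhere.\<close>
    have "A r = \<infinity>" if r: "0 < r" for r
    proof (rule ccontr)
      assume "A r \<noteq> \<infinity>"
      then have "A r < \<infinity>" by (simp add: less_top)
      then have "AE z in dunkl_lborel \<alpha>. absint z * indicator (ball 0 r) z \<noteq> \<infinity>"
        using good[OF r] by (intro nn_integral_PInf_AE) auto
      then have "AE z in lebesgue. absint z * indicator (ball 0 r) z \<noteq> \<infinity>"
        by (simp only: AE_dunkl_iff(1)[OF alpha'])
      with bad[OF s] have "AE z in lebesgue. z \<notin> ball (0::real) (min r s)"
        by eventually_elim auto
      then have "AE z in dunkl_lborel \<alpha>. z \<notin> ball 0 (min r s)"
        by (simp only: AE_dunkl_iff(1)[OF alpha'])
      then have "ball 0 (min r s) \<in> null_sets (dunkl_lborel \<alpha>)"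
        by (subst AE_iff_null_sets) auto
      then show False
        using emeasure_dunkl_ball_pos[OF alpha', of "min r s"] r s by (simp add: null_sets_def)
    qed
    \<comment> \<open>Countably many balls exhaust the line, so the union of the exceptional sets is
      still null.\<close>
    then have "AE z in lebesgue. z \<in> ball 0 (real (Suc i)) \<longrightarrow> absint z = \<infinity>" for i
      by (intro bad) auto
    then have "AE z in lebesgue. \<forall>i. z \<in> ball 0 (real (Suc i)) \<longrightarrow> absint z = \<infinity>"
      by (subst AE_all_countable) blast
    then have "AE z in lebesgue. absint z = \<infinity>"
    proof eventually_elim
      fix z :: real assume *: "\<forall>i. z \<in> ball 0 (real (Suc i)) \<longrightarrow> absint z = \<infinity>"
      obtain i where "\<bar>z\<bar> < real i" using reals_Archimedean2 by blast
      then have "z \<in> ball 0 (real (Suc i))" by simp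
      with * show "absint z = \<infinity>" by blast
    qed
    then show ?thesis by (rule that(2))
  qed
qed

lemma h_eq_0:
  assumes "absint z = \<infinity>"
  shows "h z = 0"
proof -
  have "\<not> integrable lborel (\<lambda>t. k t * f (z / t))"
    using assms by (auto simp: integrable_iff_bounded absint_def norm_mult)
  then show ?thesis
    unfolding h_def by (rule not_integrable_integral_eq)
qed

section \<open>Translation and mean under the integral sign\<close>

text \<open>For this \<alpha> the weight is constant off the origin, so the measure is invariant
  under shifts, and a shift by x maps the ball into the one enlarged by |x|. The convention
  \<open>0 powr 0 = 0\<close> makes the origin an exception, but a null one.\<close>

lemma nn_integral_absint_shift:
  assumes \<alpha>: "\<alpha> = -1/2" 
  shows "(\<integral>\<^sup>+y. absint (x + y) * indicator (ball 0 r) y \<partial>dunkl_lborel \<alpha>)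
     \<le> (\<integral>\<^sup>+z. absint z * indicator (ball 0 (r + \<bar>x\<bar>)) z \<partial>dunkl_lborel \<alpha>)"
proof -
  let ?H = "\<lambda>z. ennreal (dunkl_weight \<alpha> z) * (absint z * indicator (ball 0 (r + \<bar>x\<bar>)) z)"
  have w: "dunkl_weight \<alpha> z = dunkl_weight \<alpha> 1" if "z \<noteq> 0" for z
    using that by (simp add: dunkl_weight_def \<alpha>)
  have "(\<integral>\<^sup>+y. absint (x + y) * indicator (ball 0 r) y \<partial>dunkl_lborel \<alpha>)
     = (\<integral>\<^sup>+y. ennreal (dunkl_weight \<alpha> y) * (absint (x + y) * indicator (ball 0 r) y) \<partial>lborel)"
    unfolding dunkl_lborel_def by (rule nn_integral_density) measurable
  also have "\<dots> \<le> (\<integral>\<^sup>+y. ?H (x + y) \<partial>lborel)"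
  proof (rule nn_integral_mono_AE)
    show "AE y in lborel. ennreal (dunkl_weight \<alpha> y) * (absint (x + y) * indicator (ball 0 r) y) \<le> ?H (x + y)"
      using AE_lborel_singleton[of 0] AE_lborel_singleton[of "- x"]
    proof eventually_elim
      fix y :: real assume "y \<noteq> 0" "y \<noteq> - x"
      then have "dunkl_weight \<alpha> y = dunkl_weight \<alpha> (x + y)"
        using w[of y] w[of "x + y"] by (simp add: add_eq_0_iff)
      then show "ennreal (dunkl_weight \<alpha> y) * (absint (x + y) * indicator (ball 0 r) y) \<le> ?H (x + y)"
        by (intro mult_mono) (auto simp: indicator_def)
    qed
  qed
  also have "\<dots> = (\<integral>\<^sup>+z. ?H z \<partial>lborel)"
    using nn_integral_real_affine[of ?H 1 x] by simp
  also have "\<dots> = (\<integral>\<^sup>+z. absint z * indicator (ball 0 (r + \<bar>x\<bar>)) z \<partial>dunkl_lborel \<alpha>)"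
    unfolding dunkl_lborel_def by (rule nn_integral_density[symmetric]) measurable
  finally show ?thesis .
qed

text \<open>By Tonelli's theorem the integration over y can be done before that over z; it costs a
  constant independent of z, and what remains is the integral of \<open>absint\<close> over a larger
  ball.\<close>

lemma nn_integral_W_absint_finite:
  assumes fin: "\<forall>r>0. (\<integral>\<^sup>+z. absint z * indicator (ball 0 r) z \<partial>dunkl_lborel \<alpha>) < \<infinity>"
    and \<alpha>: "\<alpha> > -1/2" and x: "x \<noteq> 0" and r: "0 < r"
  shows "(\<integral>\<^sup>+y. indicator (ball 0 r) y * (\<integral>\<^sup>+z. ennreal \<bar>dunkl_W \<alpha> x y z\<bar> * absint z \<partial>dunkl_lborel \<alpha>) \<partial>dunkl_lborel \<alpha>) < \<infinity>"
proof -
  obtain C where C: "0 \<le> C"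
    "\<And>x z. x \<noteq> 0 \<Longrightarrow> z \<noteq> 0 \<Longrightarrow> (\<integral>\<^sup>+y. ennreal \<bar>dunkl_W \<alpha> x y z\<bar> \<partial>dunkl_lborel \<alpha>) \<le> ennreal C"
    using nn_integral_dunkl_W_bounded[OF \<alpha>] by blast
  \<comment> \<open>Larger than |x| + |y| for every y in the ball, so the kernel vanishes when z
    lies outside \<open>ball 0 ?R\<close>.\<close>
  let ?R = "r + \<bar>x\<bar> + 1"
  have "(\<integral>\<^sup>+y. indicator (ball 0 r) y * (\<integral>\<^sup>+z. ennreal \<bar>dunkl_W \<alpha> x y z\<bar> * absint z \<partial>dunkl_lborel \<alpha>) \<partial>dunkl_lborel \<alpha>)
      = (\<integral>\<^sup>+y. (\<integral>\<^sup>+z. indicator (ball 0 r) y * (ennreal \<bar>dunkl_W \<alpha> x y z\<bar> * absint z) \<partial>dunkl_lborel \<alpha>) \<partial>dunkl_lborel \<alpha>)"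
    by (intro nn_integral_cong nn_integral_cmult[symmetric]) measurable
  also have "\<dots> = (\<integral>\<^sup>+z. (\<integral>\<^sup>+y. indicator (ball 0 r) y * (ennreal \<bar>dunkl_W \<alpha> x y z\<bar> * absint z) \<partial>dunkl_lborel \<alpha>) \<partial>dunkl_lborel \<alpha>)"
    by (rule dunkl_dunkl.Fubini'[symmetric]) measurable
  also have "\<dots> \<le> (\<integral>\<^sup>+z. ennreal C * (absint z * indicator (ball 0 ?R) z) \<partial>dunkl_lborel \<alpha>)"
  proof (rule nn_integral_mono_AE)
    have "AE z in dunkl_lborel \<alpha>. z \<noteq> 0"
      unfolding AE_dunkl_iff(1)[OF alpha'] by (rule AE_lebesgue_neq)
    then show "AE z in dunkl_lborel \<alpha>. (\<integral>\<^sup>+y. indicator (ball 0 r) y * (ennreal \<bar>dunkl_W \<alpha> x y z\<bar> * absint z) \<partial>dunkl_lborel \<alpha>)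
        \<le> ennreal C * (absint z * indicator (ball 0 ?R) z)"
    proof eventually_elim
      fix z :: real assume z: "z \<noteq> 0"
      have "(\<integral>\<^sup>+y. indicator (ball 0 r) y * (ennreal \<bar>dunkl_W \<alpha> x y z\<bar> * absint z) \<partial>dunkl_lborel \<alpha>)
         \<le> (\<integral>\<^sup>+y. ennreal \<bar>dunkl_W \<alpha> x y z\<bar> * (absint z * indicator (ball 0 ?R) z) \<partial>dunkl_lborel \<alpha>)"
      proof (rule nn_integral_mono)
        fix y
        show "indicator (ball 0 r) y * (ennreal \<bar>dunkl_W \<alpha> x y z\<bar> * absint z)
            \<le> ennreal \<bar>dunkl_W \<alpha> x y z\<bar> * (absint z * indicator (ball 0 ?R) z)"
        proof (cases "z \<in> ball 0 ?R \<or> y \<notin> ball 0 r")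
          case False
          then have "dunkl_W \<alpha> x y z = 0" by (intro dunkl_W_eq_0) auto
          then show ?thesis by simp
        qed (auto simp: indicator_def)
      qed
      also have "\<dots> = (\<integral>\<^sup>+y. ennreal \<bar>dunkl_W \<alpha> x y z\<bar> \<partial>dunkl_lborel \<alpha>) * (absint z * indicator (ball 0 ?R) z)"
        by (rule nn_integral_multc) measurable
      also have "\<dots> \<le> ennreal C * (absint z * indicator (ball 0 ?R) z)"
        by (intro mult_right_mono C(2) x z) simp
      finally show "(\<integral>\<^sup>+y. indicator (ball 0 r) y * (ennreal \<bar>dunkl_W \<alpha> x y z\<bar> * absint z) \<partial>dunkl_lborel \<alpha>)
        \<le> ennreal C * (absint z * indicator (ball 0 ?R) z)" .
    qed
  qed
  also have "\<dots> = ennreal C * (\<integral>\<^sup>+z. absint z * indicator (ball 0 ?R) z \<partial>dunkl_lborel \<alpha>)"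
    by (rule nn_integral_cmult) measurable
  also have "\<dots> < \<infinity>"
    using fin[rule_format, of ?R] r by (simp add: ennreal_mult_less_top)
  finally show ?thesis .
qed

text \<open>Fubini's theorem in (t, z) for a fixed y. The second claim keeps a majorant that is
  integrable in y, since the mean has to be taken under the integral afterwards.\<close>

lemma translation_h_kernel:
  assumes \<alpha>: "\<alpha> > -1/2" and x: "x \<noteq> 0" and y: "y \<noteq> 0"
    and fin: "(\<integral>\<^sup>+z. ennreal \<bar>dunkl_W \<alpha> x y z\<bar> * absint z \<partial>dunkl_lborel \<alpha>) < \<infinity>"
  shows "dunkl_translation \<alpha> x h y = (LINT t|lborel. k t * trans_dil x t y)"
    and "(\<integral>\<^sup>+t. ennreal (cmod (k t * trans_dil x t y)) \<partial>lborel)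
       \<le> (\<integral>\<^sup>+z. ennreal \<bar>dunkl_W \<alpha> x y z\<bar> * absint z \<partial>dunkl_lborel \<alpha>)"
proof -
  let ?u = "\<lambda>t z. dunkl_W \<alpha> x y z *\<^sub>R (k t * f (z / t))"
  have trans: "trans_dil x t y = (LINT z|dunkl_lborel \<alpha>. dunkl_W \<alpha> x y z *\<^sub>R f (z / t))" for t
    unfolding trans_dil_def using \<alpha> x y by (subst dunkl_translation_eq[OF alpha']) auto
  have kt: "k t * trans_dil x t y = (LINT z|dunkl_lborel \<alpha>. ?u t z)" for t
    unfolding trans by (subst integral_mult_right_zero[symmetric]) (simp add: mult.left_commute scaleR_conv_of_real)
  have [measurable]: "(\<lambda>q. k (fst q) * f (snd q / fst q)) \<in> borel_measurable (lborel \<Otimes>\<^sub>M dunkl_lborel \<alpha>)"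
    by measurable
  have u [measurable]: "(\<lambda>q. ?u (fst q) (snd q)) \<in> borel_measurable (lborel \<Otimes>\<^sub>M dunkl_lborel \<alpha>)"
    by measurable
  have nu: "(\<lambda>(t, z). ennreal (cmod (?u t z))) \<in> borel_measurable (lborel \<Otimes>\<^sub>M dunkl_lborel \<alpha>)"
    using u by (simp add: case_prod_beta')
  have W_absint: "ennreal \<bar>dunkl_W \<alpha> x y z\<bar> * absint z = (\<integral>\<^sup>+t. ennreal (cmod (?u t z)) \<partial>lborel)" for z
    unfolding absint_def by (subst nn_integral_cmult[symmetric]) (auto simp: norm_mult simp flip: ennreal_mult)
  have Fub: "(\<integral>\<^sup>+t. \<integral>\<^sup>+z. ennreal (cmod (?u t z)) \<partial>dunkl_lborel \<alpha> \<partial>lborel)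
      = (\<integral>\<^sup>+z. ennreal \<bar>dunkl_W \<alpha> x y z\<bar> * absint z \<partial>dunkl_lborel \<alpha>)"
    unfolding W_absint by (rule lborel_dunkl.Fubini'[OF nu, symmetric])
  have int: "integrable (lborel \<Otimes>\<^sub>M dunkl_lborel \<alpha>) (case_prod ?u)"
  proof (rule integrableI_bounded)
    show "(\<lambda>(t, z). ?u t z) \<in> borel_measurable (lborel \<Otimes>\<^sub>M dunkl_lborel \<alpha>)"
      using u by (simp add: case_prod_beta')
    have "(\<integral>\<^sup>+q. ennreal (cmod (case_prod ?u q)) \<partial>(lborel \<Otimes>\<^sub>M dunkl_lborel \<alpha>))
        = (\<integral>\<^sup>+t. \<integral>\<^sup>+z. ennreal (cmod (?u t z)) \<partial>dunkl_lborel \<alpha> \<partial>lborel)"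
      using dunkl.nn_integral_fst[OF nu] by (simp add: case_prod_beta')
    then show "(\<integral>\<^sup>+q. ennreal (cmod (case_prod ?u q)) \<partial>(lborel \<Otimes>\<^sub>M dunkl_lborel \<alpha>)) < \<infinity>"
      using fin Fub by simp
  qed
  have "dunkl_translation \<alpha> x h y = (LINT z|dunkl_lborel \<alpha>. dunkl_W \<alpha> x y z *\<^sub>R h z)"
    using \<alpha> x y by (subst dunkl_translation_eq[OF alpha']) auto
  also have "\<dots> = (LINT z|dunkl_lborel \<alpha>. LINT t|lborel. ?u t z)"
    unfolding h_def by simp
  also have "\<dots> = (LINT t|lborel. LINT z|dunkl_lborel \<alpha>. ?u t z)"
    by (rule lborel_dunkl.Fubini_integral[OF int])
  also have "\<dots> = (LINT t|lborel. k t * trans_dil x t y)"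
    unfolding kt ..
  finally show "dunkl_translation \<alpha> x h y = (LINT t|lborel. k t * trans_dil x t y)" .
  have "(\<integral>\<^sup>+t. ennreal (cmod (k t * trans_dil x t y)) \<partial>lborel)
      \<le> (\<integral>\<^sup>+t. \<integral>\<^sup>+z. ennreal (cmod (?u t z)) \<partial>dunkl_lborel \<alpha> \<partial>lborel)"
  proof (rule nn_integral_mono)
    fix t
    \<comment> \<open>Where the inner integral does not converge absolutely its value is 0, so the
      bound holds for every t.\<close>
    show "ennreal (cmod (k t * trans_dil x t y)) \<le> (\<integral>\<^sup>+z. ennreal (cmod (?u t z)) \<partial>dunkl_lborel \<alpha>)"
      unfolding kt
    proof (cases "integrable (dunkl_lborel \<alpha>) (?u t)")
      case True
      then show "ennreal (cmod (LINT z|dunkl_lborel \<alpha>. ?u t z)) \<le> (\<integral>\<^sup>+z. ennreal (cmod (?u t z)) \<partial>dunkl_lborel \<alpha>)"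
        by (rule integral_norm_bound_ennreal)
    qed (simp add: not_integrable_integral_eq)
  qed
  then show "(\<integral>\<^sup>+t. ennreal (cmod (k t * trans_dil x t y)) \<partial>lborel)
       \<le> (\<integral>\<^sup>+z. ennreal \<bar>dunkl_W \<alpha> x y z\<bar> * absint z \<partial>dunkl_lborel \<alpha>)"
    unfolding Fub .
qed

text \<open>If \<alpha> = -1/2 or x = 0, the translation is evaluation at x + y for y off the
  origin; the identity is then the definition of \<open>h\<close>, and only the majorant needs an
  argument. Otherwise both claims come from the kernel, at the almost all y where its absolute
  integral against \<open>absint\<close> is finite.\<close>

lemma translation_h:
  assumes fin: "\<forall>r>0. (\<integral>\<^sup>+z. absint z * indicator (ball 0 r) z \<partial>dunkl_lborel \<alpha>) < \<infinity>"
    and r: "0 < r"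
  shows "AE y in dunkl_lborel \<alpha>. y \<in> ball 0 r \<longrightarrow> dunkl_translation \<alpha> x h y = (LINT t|lborel. k t * trans_dil x t y)"
    and "(\<integral>\<^sup>+y. indicator (ball 0 r) y * (\<integral>\<^sup>+t. ennreal (cmod (k t * trans_dil x t y)) \<partial>lborel) \<partial>dunkl_lborel \<alpha>) < \<infinity>"
proof -
  have y0: "AE y in dunkl_lborel \<alpha>. y \<noteq> 0"
    unfolding AE_dunkl_iff(1)[OF alpha'] by (rule AE_lebesgue_neq)
  have "(AE y in dunkl_lborel \<alpha>. y \<in> ball 0 r \<longrightarrow> dunkl_translation \<alpha> x h y = (LINT t|lborel. k t * trans_dil x t y))
    \<and> (\<integral>\<^sup>+y. indicator (ball 0 r) y * (\<integral>\<^sup>+t. ennreal (cmod (k t * trans_dil x t y)) \<partial>lborel) \<partial>dunkl_lborel \<alpha>) < \<infinity>"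
  proof (cases "\<alpha> = -1/2 \<or> x = 0")
    case True
    have T: "dunkl_translation \<alpha> x g y = g (x + y)" if "y \<noteq> 0" for g y
      using True that by (auto simp: dunkl_translation_def)
    have "(\<integral>\<^sup>+y. indicator (ball 0 r) y * (\<integral>\<^sup>+t. ennreal (cmod (k t * trans_dil x t y)) \<partial>lborel) \<partial>dunkl_lborel \<alpha>)
       = (\<integral>\<^sup>+y. absint (x + y) * indicator (ball 0 r) y \<partial>dunkl_lborel \<alpha>)"
    proof (rule nn_integral_cong_AE)
      show "AE y in dunkl_lborel \<alpha>. indicator (ball 0 r) y * (\<integral>\<^sup>+t. ennreal (cmod (k t * trans_dil x t y)) \<partial>lborel)
          = absint (x + y) * indicator (ball 0 r) y"
        using y0 by eventually_elim (simp add: trans_dil_def T absint_def norm_mult mult.commute)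
    qed
    also have "\<dots> < \<infinity>"
    proof (cases "x = 0")
      case False
      then show ?thesis
        using True nn_integral_absint_shift[of x r] fin[rule_format, of "r + \<bar>x\<bar>"] r by (auto intro: order_le_less_trans)
    qed (use fin[rule_format, OF r] in simp)
    finally have "(\<integral>\<^sup>+y. indicator (ball 0 r) y * (\<integral>\<^sup>+t. ennreal (cmod (k t * trans_dil x t y)) \<partial>lborel) \<partial>dunkl_lborel \<alpha>) < \<infinity>" .
    moreover have "AE y in dunkl_lborel \<alpha>. y \<in> ball 0 r \<longrightarrow> dunkl_translation \<alpha> x h y = (LINT t|lborel. k t * trans_dil x t y)"
      using y0 by eventually_elim (simp add: trans_dil_def T h_def)
    ultimately show ?thesis by blast
  next
    case False
    then have \<alpha>: "\<alpha> > -1/2" and x: "x \<noteq> 0" using alpha by auto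
    let ?P = "\<lambda>y. \<integral>\<^sup>+z. ennreal \<bar>dunkl_W \<alpha> x y z\<bar> * absint z \<partial>dunkl_lborel \<alpha>"
    have [measurable]: "?P \<in> borel_measurable (dunkl_lborel \<alpha>)"
      by measurable
    have P: "(\<integral>\<^sup>+y. indicator (ball 0 r) y * ?P y \<partial>dunkl_lborel \<alpha>) < \<infinity>"
      by (rule nn_integral_W_absint_finite[OF fin \<alpha> x r])
    have P_AE: "AE y in dunkl_lborel \<alpha>. indicator (ball 0 r) y * ?P y \<noteq> \<infinity>"
      using P by (intro nn_integral_PInf_AE) auto
    have "AE y in dunkl_lborel \<alpha>. y \<in> ball 0 r \<longrightarrow> dunkl_translation \<alpha> x h y = (LINT t|lborel. k t * trans_dil x t y)"
      using P_AE y0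
    proof eventually_elim
      fix y :: real assume "indicator (ball 0 r) y * ?P y \<noteq> \<infinity>" "y \<noteq> 0"
      then show "y \<in> ball 0 r \<longrightarrow> dunkl_translation \<alpha> x h y = (LINT t|lborel. k t * trans_dil x t y)"
        using translation_h_kernel(1)[OF \<alpha> x, of y] by (auto simp: less_top)
    qed
    moreover have "(\<integral>\<^sup>+y. indicator (ball 0 r) y * (\<integral>\<^sup>+t. ennreal (cmod (k t * trans_dil x t y)) \<partial>lborel) \<partial>dunkl_lborel \<alpha>)
        \<le> (\<integral>\<^sup>+y. indicator (ball 0 r) y * ?P y \<partial>dunkl_lborel \<alpha>)"
    proof (rule nn_integral_mono_AE)
      show "AE y in dunkl_lborel \<alpha>. indicator (ball 0 r) y * (\<integral>\<^sup>+t. ennreal (cmod (k t * trans_dil x t y)) \<partial>lborel)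
          \<le> indicator (ball 0 r) y * ?P y"
        using P_AE y0
      proof eventually_elim
        fix y :: real assume "indicator (ball 0 r) y * ?P y \<noteq> \<infinity>" "y \<noteq> 0"
        then show "indicator (ball 0 r) y * (\<integral>\<^sup>+t. ennreal (cmod (k t * trans_dil x t y)) \<partial>lborel)
          \<le> indicator (ball 0 r) y * ?P y"
          using translation_h_kernel(2)[OF \<alpha> x, of y] by (cases "y \<in> ball 0 r") (auto simp: less_top)
      qed
    qed
    ultimately show ?thesis using P by (auto intro: order_le_less_trans)
  qed
  then show "AE y in dunkl_lborel \<alpha>. y \<in> ball 0 r \<longrightarrow> dunkl_translation \<alpha> x h y = (LINT t|lborel. k t * trans_dil x t y)"
    and "(\<integral>\<^sup>+y. indicator (ball 0 r) y * (\<integral>\<^sup>+t. ennreal (cmod (k t * trans_dil x t y)) \<partial>lborel) \<partial>dunkl_lborel \<alpha>) < \<infinity>"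
    by blast+
qed

text \<open>Fubini's theorem in (t, y) on the ball. The two integrability claims are recorded
  because the integrals for translation and mean can be subtracted only when each converges
  separately.\<close>

lemma mean_h:
  assumes fin: "\<forall>r>0. (\<integral>\<^sup>+z. absint z * indicator (ball 0 r) z \<partial>dunkl_lborel \<alpha>) < \<infinity>"
    and r: "0 < r"
  shows "dunkl_mean \<alpha> h r x = (LINT t|lborel. k t * mean_dil r x t)"
    and "integrable lborel (\<lambda>t. k t * mean_dil r x t)"
    and "AE y in dunkl_lborel \<alpha>. y \<in> ball 0 r \<longrightarrow> integrable lborel (\<lambda>t. k t * trans_dil x t y)"
proof -
  let ?u = "\<lambda>t y. indicator (ball 0 r) y *\<^sub>R (k t * trans_dil x t y)"
  let ?c = "measure (dunkl_lborel \<alpha>) (ball 0 r)"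
  have c: "?c \<noteq> 0"
    using emeasure_dunkl_ball_pos[OF alpha' r] emeasure_dunkl_ball_finite[OF alpha, of r]
    by (auto simp: measure_def enn2real_eq_0_iff)
  have u [measurable]: "(\<lambda>q. ?u (fst q) (snd q)) \<in> borel_measurable (lborel \<Otimes>\<^sub>M dunkl_lborel \<alpha>)"
    by measurable
  have nu: "(\<lambda>(t, y). ennreal (cmod (?u t y))) \<in> borel_measurable (lborel \<Otimes>\<^sub>M dunkl_lborel \<alpha>)"
    using u by (simp add: case_prod_beta')
  have int: "integrable (lborel \<Otimes>\<^sub>M dunkl_lborel \<alpha>) (case_prod ?u)"
  proof (rule integrableI_bounded)
    show "(\<lambda>(t, y). ?u t y) \<in> borel_measurable (lborel \<Otimes>\<^sub>M dunkl_lborel \<alpha>)"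
      using u by (simp add: case_prod_beta')
    have "(\<integral>\<^sup>+q. ennreal (cmod (case_prod ?u q)) \<partial>(lborel \<Otimes>\<^sub>M dunkl_lborel \<alpha>))
        = (\<integral>\<^sup>+y. \<integral>\<^sup>+t. ennreal (cmod (?u t y)) \<partial>lborel \<partial>dunkl_lborel \<alpha>)"
      using lborel_dunkl.nn_integral_snd[OF nu] by (simp add: case_prod_beta')
    also have "\<dots> = (\<integral>\<^sup>+y. indicator (ball 0 r) y * (\<integral>\<^sup>+t. ennreal (cmod (k t * trans_dil x t y)) \<partial>lborel) \<partial>dunkl_lborel \<alpha>)"
    proof (rule nn_integral_cong)
      fix y
      show "(\<integral>\<^sup>+t. ennreal (cmod (?u t y)) \<partial>lborel)
          = indicator (ball 0 r) y * (\<integral>\<^sup>+t. ennreal (cmod (k t * trans_dil x t y)) \<partial>lborel)"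
        by (cases "y \<in> ball 0 r") simp_all
    qed
    also have "\<dots> < \<infinity>"
      by (rule translation_h(2)[OF fin r])
    finally show "(\<integral>\<^sup>+q. ennreal (cmod (case_prod ?u q)) \<partial>(lborel \<Otimes>\<^sub>M dunkl_lborel \<alpha>)) < \<infinity>" .
  qed
  have inner: "(LINT y|dunkl_lborel \<alpha>. ?u t y) = ?c *\<^sub>R (k t * mean_dil r x t)" for t
  proof -
    have "(LINT y|dunkl_lborel \<alpha>. ?u t y) = (LINT y|dunkl_lborel \<alpha>. k t * (indicator (ball 0 r) y *\<^sub>R trans_dil x t y))"
      by (simp add: scaleR_conv_of_real mult.left_commute)
    also have "\<dots> = k t * (LINT y|dunkl_lborel \<alpha>. indicator (ball 0 r) y *\<^sub>R trans_dil x t y)"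
      by (rule integral_mult_right_zero)
    also have "\<dots> = ?c *\<^sub>R (k t * mean_dil r x t)"
      unfolding mean_dil_eq using c by (simp add: scaleR_conv_of_real)
    finally show ?thesis .
  qed
  have "integrable lborel (\<lambda>t. ?c *\<^sub>R (k t * mean_dil r x t))"
    using lborel_dunkl.integrable_fst'[OF int] by (simp add: inner)
  then have "integrable lborel (\<lambda>t. (1 / ?c) *\<^sub>R ?c *\<^sub>R (k t * mean_dil r x t))"
    by (rule integrable_scaleR_right)
  then show "integrable lborel (\<lambda>t. k t * mean_dil r x t)"
    using c by simp
  have "AE y in dunkl_lborel \<alpha>. integrable lborel (\<lambda>t. ?u t y)"
    using lborel_dunkl.AE_integrable_snd[OF int] .
  then show "AE y in dunkl_lborel \<alpha>. y \<in> ball 0 r \<longrightarrow> integrable lborel (\<lambda>t. k t * trans_dil x t y)"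
    by eventually_elim auto
  have [measurable]: "dunkl_translation \<alpha> x h \<in> borel_measurable borel"
    using alpha' measurable_h by (rule measurable_dunkl_translation_const)
  have [measurable]: "(\<lambda>y. LINT t|lborel. ?u t y) \<in> borel_measurable (dunkl_lborel \<alpha>)"
    using lborel_dunkl.integrable_snd[OF int] by (rule borel_measurable_integrable)
  have "(LINT y|dunkl_lborel \<alpha>. indicator (ball 0 r) y *\<^sub>R dunkl_translation \<alpha> x h y)
      = (LINT y|dunkl_lborel \<alpha>. LINT t|lborel. ?u t y)"
  proof (rule integral_cong_AE)
    show "AE y in dunkl_lborel \<alpha>. indicator (ball 0 r) y *\<^sub>R dunkl_translation \<alpha> x h y = (LINT t|lborel. ?u t y)"
      using translation_h(1)[OF fin r, of x]
    proof eventually_elim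
      fix y assume "y \<in> ball 0 r \<longrightarrow> dunkl_translation \<alpha> x h y = (LINT t|lborel. k t * trans_dil x t y)"
      then show "indicator (ball 0 r) y *\<^sub>R dunkl_translation \<alpha> x h y = (LINT t|lborel. ?u t y)"
        by (cases "y \<in> ball 0 r") simp_all
    qed
  qed measurable
  also have "\<dots> = (LINT t|lborel. LINT y|dunkl_lborel \<alpha>. ?u t y)"
    by (rule lborel_dunkl.Fubini_integral[OF int])
  also have "\<dots> = ?c *\<^sub>R (LINT t|lborel. k t * mean_dil r x t)"
    unfolding inner by simp
  finally show "dunkl_mean \<alpha> h r x = (LINT t|lborel. k t * mean_dil r x t)"
    unfolding dunkl_mean_eq[OF alpha' measurable_h] using c by simp
qed

text \<open>By linearity the deviation of \<open>h\<close> from its mean is the integral against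
  \<open>k\<close> of the deviations of the dilates; moving the norm inside leaves the quantity
  bounded in \<open>osc_dil_le\<close>.\<close>

lemma osc_h_le:
  assumes fin: "\<forall>r>0. (\<integral>\<^sup>+z. absint z * indicator (ball 0 r) z \<partial>dunkl_lborel \<alpha>) < \<infinity>"
    and r: "0 < r"
  shows "dunkl_osc \<alpha> p h r x \<le> ennreal ((N * K * \<phi> r) powr p) * emeasure (dunkl_lborel \<alpha>) (ball 0 r)"
proof -
  let ?X = "\<lambda>y. \<integral>\<^sup>+t. ennreal (cmod (k t) * (indicator (ball 0 r) y * cmod (trans_dil x t y - mean_dil r x t))) \<partial>lborel"
  have "dunkl_osc \<alpha> p h r x \<le> (\<integral>\<^sup>+y. ennreal_power (?X y) p \<partial>dunkl_lborel \<alpha>)"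
    unfolding dunkl_osc_def
  proof (rule nn_integral_mono_AE)
    show "AE y in dunkl_lborel \<alpha>. ennreal (cmod (dunkl_translation \<alpha> x h y - dunkl_mean \<alpha> h r x) powr p) * indicator (ball 0 r) y
        \<le> ennreal_power (?X y) p"
      using translation_h(1)[OF fin r, of x] mean_h(3)[OF fin r, of x]
    proof eventually_elim
      fix y
      assume T: "y \<in> ball 0 r \<longrightarrow> dunkl_translation \<alpha> x h y = (LINT t|lborel. k t * trans_dil x t y)"
        and int: "y \<in> ball 0 r \<longrightarrow> integrable lborel (\<lambda>t. k t * trans_dil x t y)"
      show "ennreal (cmod (dunkl_translation \<alpha> x h y - dunkl_mean \<alpha> h r x) powr p) * indicator (ball 0 r) y
          \<le> ennreal_power (?X y) p"
      proof (cases "y \<in> ball 0 r")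
        case True
        have int': "integrable lborel (\<lambda>t. k t * trans_dil x t y - k t * mean_dil r x t)"
          using int True mean_h(2)[OF fin r, of x] by (intro Bochner_Integration.integrable_diff) auto
        have "dunkl_translation \<alpha> x h y - dunkl_mean \<alpha> h r x
            = (LINT t|lborel. k t * trans_dil x t y - k t * mean_dil r x t)"
          using T int True mean_h(1,2)[OF fin r, of x] by (simp add: Bochner_Integration.integral_diff)
        then have "ennreal (cmod (dunkl_translation \<alpha> x h y - dunkl_mean \<alpha> h r x))
            \<le> (\<integral>\<^sup>+t. ennreal (cmod (k t * trans_dil x t y - k t * mean_dil r x t)) \<partial>lborel)"
          using integral_norm_bound_ennreal[OF int'] by simp
        also have "\<dots> = ?X y"
          using True by (simp add: norm_mult flip: right_diff_distrib)
        finally have le: "ennreal (cmod (dunkl_translation \<alpha> x h y - dunkl_mean \<alpha> h r x)) \<le> ?X y" .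
        show ?thesis
        proof (cases "?X y")
          case (real u)
          then have "cmod (dunkl_translation \<alpha> x h y - dunkl_mean \<alpha> h r x) powr p \<le> u powr p"
            using le p by (intro powr_mono2) (auto simp: ennreal_le_iff)
          then show ?thesis
            using True real by (simp add: ennreal_power_def ennreal_leI)
        qed (simp add: ennreal_power_def)
      qed simp
    qed
  qed
  then show ?thesis using osc_dil_le[OF r, of x] by (rule order_trans)
qed

lemma campanato_norm_h: "campanato_norm \<alpha> p \<phi> h \<le> ennreal (N * K)"
proof (rule absint_dichotomy)
  assume "\<And>r. 0 < r \<Longrightarrow> (\<integral>\<^sup>+z. absint z * indicator (ball 0 r) z \<partial>dunkl_lborel \<alpha>) < \<infinity>"
  then have "\<forall>r>0. (\<integral>\<^sup>+z. absint z * indicator (ball 0 r) z \<partial>dunkl_lborel \<alpha>) < \<infinity>" by blast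
  from osc_h_le[OF this] show ?thesis
    using N(1) K(1) by (subst campanato_norm_le_iff[OF alpha p phi_pos measurable_h]) auto
next
  assume "AE z in lebesgue. absint z = \<infinity>"
  then have "AE z in lebesgue. h z = 0"
    by eventually_elim (rule h_eq_0)
  then have "campanato_norm \<alpha> p \<phi> h = campanato_norm \<alpha> p \<phi> (\<lambda>_. 0)"
    by (rule campanato_norm_cong_AE[OF alpha']) simp
  then show ?thesis
    using campanato_norm_0[OF alpha p phi_pos] by simp
qed

end

section \<open>Lebesgue measurable functions\<close>

text \<open>At centre 0 the oscillation on a ball containing the compact set controls f minus a
  constant, and constants are p-integrable on the ball. Thus the norm bound alone places the image
  of the operator in the space.\<close>

lemma locally_p_integrableI:
  assumes \<alpha>: "\<alpha> \<ge> -1/2" and p: "1 \<le> p" and \<phi>: "\<And>r. 0 < r \<Longrightarrow> 0 < \<phi> r"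
    and f: "f \<in> borel_measurable lebesgue" and fin: "campanato_norm \<alpha> p \<phi> f < \<infinity>"
  shows "locally_p_integrable \<alpha> p f"
  unfolding locally_p_integrable_def
proof (intro conjI allI impI)
  show "f \<in> borel_measurable lebesgue" by (rule f)
  have \<alpha>1: "\<alpha> > -1" using \<alpha> by simp
  obtain g where g [measurable]: "g \<in> borel_measurable borel" and fg: "AE x in lebesgue. f x = g x"
    using ex_borel_version_complex[OF f] .
  obtain N where N: "campanato_norm \<alpha> p \<phi> g = ennreal N" "0 \<le> N"
    using fin unfolding campanato_norm_cong_AE[OF \<alpha>1 fg g] by (cases "campanato_norm \<alpha> p \<phi> g") auto
  fix K :: "real set" assume K: "compact K"
  then have [measurable]: "K \<in> sets borel" by (intro borel_compact)
  obtain r where r: "0 < r" "K \<subseteq> ball 0 r"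
    using compact_imp_bounded[OF K] bounded_subset_ballD by blast
  let ?c = "dunkl_mean \<alpha> g r 0"
  have [measurable]: "dunkl_translation \<alpha> 0 g \<in> borel_measurable borel"
    using \<alpha>1 g by (rule measurable_dunkl_translation_const)
  have "(\<integral>\<^sup>+x. ennreal (indicator K x * cmod (f x) powr p) \<partial>dunkl_measure \<alpha>)
      = (\<integral>\<^sup>+x. ennreal (indicator K x * cmod (g x) powr p) \<partial>dunkl_lborel \<alpha>)"
  proof (rule nn_integral_dunkl_measure_AE_eq[OF \<alpha>1])
    show "AE x in lebesgue. ennreal (indicator K x * cmod (f x) powr p) = ennreal (indicator K x * cmod (g x) powr p)"
      using fg by eventually_elim simp
  qed measurable
  also have "\<dots> \<le> (\<integral>\<^sup>+x. ennreal (2 powr p) * (ennreal (cmod (dunkl_translation \<alpha> 0 g x - ?c) powr p) * indicator (ball 0 r) x)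
      + ennreal (2 powr p * cmod ?c powr p) * indicator (ball 0 r) x \<partial>dunkl_lborel \<alpha>)"
  proof (rule nn_integral_mono_AE)
    have "AE x in dunkl_lborel \<alpha>. x \<noteq> 0"
      unfolding AE_dunkl_iff(1)[OF \<alpha>1] by (rule AE_lebesgue_neq)
    then show "AE x in dunkl_lborel \<alpha>. ennreal (indicator K x * cmod (g x) powr p)
      \<le> ennreal (2 powr p) * (ennreal (cmod (dunkl_translation \<alpha> 0 g x - ?c) powr p) * indicator (ball 0 r) x)
        + ennreal (2 powr p * cmod ?c powr p) * indicator (ball 0 r) x"
    proof eventually_elim
      fix x :: real assume x: "x \<noteq> 0"
      have T: "dunkl_translation \<alpha> 0 g x = g x" using x by (simp add: dunkl_translation_def)
      show "ennreal (indicator K x * cmod (g x) powr p)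
        \<le> ennreal (2 powr p) * (ennreal (cmod (dunkl_translation \<alpha> 0 g x - ?c) powr p) * indicator (ball 0 r) x)
          + ennreal (2 powr p * cmod ?c powr p) * indicator (ball 0 r) x"
      proof (cases "x \<in> K")
        case True
        let ?a = "cmod (g x - ?c)" and ?b = "cmod ?c"
        have "cmod (g x) \<le> ?a + ?b"
          using norm_triangle_ineq[of "g x - ?c" ?c] by simp
        then have "cmod (g x) powr p \<le> (2 * max ?a ?b) powr p"
          using p by (intro powr_mono2) auto
        also have "\<dots> = 2 powr p * max ?a ?b powr p"
          by (simp add: powr_mult)
        also have "max ?a ?b powr p \<le> ?a powr p + ?b powr p"
          by (simp add: max_def)
        finally have "cmod (g x) powr p \<le> 2 powr p * ?a powr p + 2 powr p * ?b powr p"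
          by (simp add: distrib_left)
        then have "ennreal (cmod (g x) powr p) \<le> ennreal (2 powr p * ?a powr p + 2 powr p * ?b powr p)"
          by (rule ennreal_leI)
        then show ?thesis
          using True r(2) by (auto simp: T ennreal_plus ennreal_mult)
      qed simp
    qed
  qed
  also have "\<dots> = ennreal (2 powr p) * dunkl_osc \<alpha> p g r 0
      + ennreal (2 powr p * cmod ?c powr p) * emeasure (dunkl_lborel \<alpha>) (ball 0 r)"
    unfolding dunkl_osc_def by (simp add: nn_integral_add nn_integral_cmult nn_integral_cmult_indicator)
  also have "\<dots> < \<infinity>"
  proof -
    have "dunkl_osc \<alpha> p g r 0 \<le> ennreal ((N * \<phi> r) powr p) * emeasure (dunkl_lborel \<alpha>) (ball 0 r)"
      using campanato_norm_le_iff[of \<alpha> p \<phi> g N] \<alpha> p \<phi> g N r(1) by simp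
    also have "\<dots> < \<infinity>"
      using emeasure_dunkl_ball_finite[OF \<alpha>, of r] by (simp add: ennreal_mult_less_top)
    finally show ?thesis
      using emeasure_dunkl_ball_finite[OF \<alpha>, of r] by (simp add: ennreal_mult_less_top)
  qed
  finally have "(\<integral>\<^sup>+x. ennreal (indicator K x * cmod (f x) powr p) \<partial>dunkl_measure \<alpha>) < \<infinity>" .
  moreover have "(\<lambda>x. indicator K x * cmod (f x) powr p) \<in> borel_measurable lebesgue"
  proof (rule borel_measurable_lebesgue_AE_eq)
    show "AE x in lebesgue. indicator K x * cmod (f x) powr p = indicator K x * cmod (g x) powr p"
      using fg by eventually_elim simp
    show "(\<lambda>x. indicator K x * cmod (g x) powr p) \<in> borel_measurable lebesgue"
      by (rule measurable_completion) measurable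
  qed
  then have "(\<lambda>x. indicator K x * cmod (f x) powr p) \<in> borel_measurable (dunkl_measure \<alpha>)"
    by (simp only: measurable_cong_sets[OF sets_dunkl_measure refl])
  ultimately show "set_integrable (dunkl_measure \<alpha>) K (\<lambda>x. cmod (f x) powr p)"
    unfolding set_integrable_def by (intro integrableI_bounded) (simp_all add: abs_mult)
qed

text \<open>\<phi> is extended by 0, replaced by a Borel function \<theta> almost everywhere, and
  composed with t -> r / |t|. Where \<theta> fails to be positive the value 1 is substituted; as
  \<phi> is positive this happens only on a null set.\<close>

lemma ex_borel_version_dilation:
  fixes \<phi> :: "real \<Rightarrow> real"
  assumes meas: "\<phi> \<in> borel_measurable (lebesgue_on {0<..})" and pos: "\<And>r. 0 < r \<Longrightarrow> 0 < \<phi> r" and r: "0 < r"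
  shows "\<exists>n\<in>borel_measurable borel. (\<forall>t. 0 < n t) \<and> (AE t in lborel. n t = \<phi> (r / \<bar>t\<bar>))"
proof -
  have "(\<lambda>s. if s \<in> {0<..} then \<phi> s else 0) \<in> borel_measurable lebesgue"
    using meas by (rule borel_measurable_if_I) simp
  from completion_ex_borel_measurable_real[OF this] obtain \<theta> where [measurable]: "\<theta> \<in> borel_measurable borel"
    and "AE s in lborel. (if s \<in> {0<..} then \<phi> s else 0) = \<theta> s" by auto
  then have \<theta>: "AE s in lebesgue. (if s \<in> {0<..} then \<phi> s else 0) = \<theta> s"
    by (simp only: AE_completion_iff)
  \<comment> \<open>The map t -> r / |t| is not injective, but it is r / t or -r / t according to
    the sign of t, and both of these pull null sets back to null sets.\<close>
  have "r \<noteq> 0" "- r \<noteq> 0" using r by auto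
  from AE_lebesgue_divide[OF \<theta> this(1)] AE_lebesgue_divide[OF \<theta> this(2)] AE_lebesgue_neq[of 0]
  have "AE t in lebesgue. (if 0 < \<theta> (r / \<bar>t\<bar>) then \<theta> (r / \<bar>t\<bar>) else 1) = \<phi> (r / \<bar>t\<bar>)"
  proof eventually_elim
    fix t :: real
    assume 1: "(if r / t \<in> {0<..} then \<phi> (r / t) else 0) = \<theta> (r / t)"
      and 2: "(if - r / t \<in> {0<..} then \<phi> (- r / t) else 0) = \<theta> (- r / t)"
      and t: "t \<noteq> 0"
    have "r / \<bar>t\<bar> = r / t \<and> t > 0 \<or> r / \<bar>t\<bar> = - r / t \<and> t < 0"
      using t by (cases "t > 0") auto
    then have "\<theta> (r / \<bar>t\<bar>) = \<phi> (r / \<bar>t\<bar>)"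
      using 1 2 r by (auto simp: zero_less_divide_iff divide_less_0_iff)
    then show "(if 0 < \<theta> (r / \<bar>t\<bar>) then \<theta> (r / \<bar>t\<bar>) else 1) = \<phi> (r / \<bar>t\<bar>)"
      using pos[of "r / \<bar>t\<bar>"] r t by simp
  qed
  then show ?thesis
    by (intro bexI[of _ "\<lambda>t. if 0 < \<theta> (r / \<bar>t\<bar>) then \<theta> (r / \<bar>t\<bar>) else 1"]) (auto simp: AE_completion_iff)
qed


lemma dunkl_hausdorff_bound:
  assumes \<alpha>: "\<alpha> \<ge> -1/2" and p: "1 \<le> p" and \<phi>: "\<And>r. 0 < r \<Longrightarrow> 0 < \<phi> r"
    and \<phi>_meas: "\<phi> \<in> borel_measurable (lebesgue_on {0<..})"
    and \<psi>: "\<psi> \<in> borel_measurable lebesgue" and K: "hausdorff_const \<alpha> \<phi> \<psi> < \<infinity>"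
    and f: "f \<in> borel_measurable lebesgue" and N: "campanato_norm \<alpha> p \<phi> f < \<infinity>"
  shows "dunkl_hausdorff \<alpha> \<psi> f \<in> borel_measurable lebesgue"
    and "campanato_norm \<alpha> p \<phi> (dunkl_hausdorff \<alpha> \<psi> f) \<le> hausdorff_const \<alpha> \<phi> \<psi> * campanato_norm \<alpha> p \<phi> f"
proof -
  have \<alpha>1: "\<alpha> > -1" using \<alpha> by simp
  obtain g where g [measurable]: "g \<in> borel_measurable borel" and fg: "AE x in lebesgue. f x = g x"
    using ex_borel_version_complex[OF f] .
  obtain q where q [measurable]: "q \<in> borel_measurable borel" and psi_q: "AE x in lebesgue. \<psi> x = q x"
    using ex_borel_version_complex[OF \<psi>] .
  define k where "k t = q t / of_real (\<bar>t\<bar> powr (2 * \<alpha> + 2))" for t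
  have k_meas [measurable]: "k \<in> borel_measurable borel"
    unfolding k_def by measurable
  obtain n where n: "campanato_norm \<alpha> p \<phi> f = ennreal n" "0 \<le> n"
    using N by (cases "campanato_norm \<alpha> p \<phi> f") auto
  obtain c where c: "hausdorff_const \<alpha> \<phi> \<psi> = ennreal c" "0 \<le> c"
    using K by (cases "hausdorff_const \<alpha> \<phi> \<psi>") auto
  have norm_eq: "campanato_norm \<alpha> p \<phi> f = campanato_norm \<alpha> p \<phi> g"
    using \<alpha>1 fg g by (rule campanato_norm_cong_AE)
  have c_bound: "(\<integral>\<^sup>+t. ennreal (cmod (k t) * \<phi> (r / \<bar>t\<bar>)) \<partial>lborel) \<le> ennreal (c * \<phi> r)" if r: "0 < r" for r
  proof -
    let ?X = "\<integral>\<^sup>+t. ennreal (cmod (\<psi> t) / \<bar>t\<bar> powr dunkl_dim \<alpha> * \<phi> (r / \<bar>t\<bar>)) \<partial>lebesgue"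
    have "(\<integral>\<^sup>+t. ennreal (cmod (k t) * \<phi> (r / \<bar>t\<bar>)) \<partial>lborel) = (\<integral>\<^sup>+t. ennreal (cmod (k t) * \<phi> (r / \<bar>t\<bar>)) \<partial>lebesgue)"
      by (simp only: nn_integral_completion)
    also have "\<dots> = ?X"
    proof (rule nn_integral_cong_AE)
      show "AE t in lebesgue. ennreal (cmod (k t) * \<phi> (r / \<bar>t\<bar>)) = ennreal (cmod (\<psi> t) / \<bar>t\<bar> powr dunkl_dim \<alpha> * \<phi> (r / \<bar>t\<bar>))"
        using psi_q by eventually_elim (simp add: k_def dunkl_dim_def norm_divide)
    qed
    finally have eq: "(\<integral>\<^sup>+t. ennreal (cmod (k t) * \<phi> (r / \<bar>t\<bar>)) \<partial>lborel) = ?X" .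
    have "?X / ennreal (\<phi> r) \<le> hausdorff_const \<alpha> \<phi> \<psi>"
      unfolding hausdorff_const_def using r by (intro SUP_upper) simp
    then have le: "?X / ennreal (\<phi> r) \<le> ennreal c" unfolding c .
    have "?X \<le> ennreal (c * \<phi> r)"
    proof (cases ?X)
      case (real u)
      then have "u / \<phi> r \<le> c"
        using le \<phi>[OF r] c(2) by (simp add: divide_ennreal)
      then have "u \<le> c * \<phi> r" using \<phi>[OF r] by (simp add: pos_divide_le_eq)
      then show ?thesis unfolding real by (rule ennreal_leI)
    next
      case top
      then show ?thesis using le by (simp add: ennreal_top_divide top_unique)
    qed
    then show ?thesis unfolding eq .
  qed
  interpret campanato_hausdorff \<alpha> p n c \<phi> k g
    using \<alpha> p \<phi> k_meas g n c c_bound ex_borel_version_dilation[OF \<phi>_meas \<phi>] norm_eq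
    by unfold_locales auto
  \<comment> \<open>For x off the origin t -> x / t pulls null sets back to null sets, so passing
    from f to its Borel version leaves the integral unchanged. At x = 0 the integrand involves only
    the single value of f at 0, so this point is left out.\<close>
  have H_eq: "AE x in lebesgue. dunkl_hausdorff \<alpha> \<psi> f x = h x"
    using AE_lebesgue_neq[of 0]
  proof eventually_elim
    fix x :: real assume "x \<noteq> 0"
    from AE_lebesgue_divide[OF fg this] psi_q
    have "AE t in lebesgue. \<psi> t / of_real (\<bar>t\<bar> powr (2 * \<alpha> + 2)) * f (x / t) = k t * g (x / t)"
      by eventually_elim (simp add: k_def)
    then show "dunkl_hausdorff \<alpha> \<psi> f x = h x"
      unfolding dunkl_hausdorff_def h_def by (rule integral_lebesgue_AE_eq) measurable
  qed
  have "h \<in> borel_measurable lebesgue"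
    by (rule measurable_completion) simp
  with H_eq show "dunkl_hausdorff \<alpha> \<psi> f \<in> borel_measurable lebesgue"
    by (rule borel_measurable_lebesgue_AE_eq)
  have "campanato_norm \<alpha> p \<phi> (dunkl_hausdorff \<alpha> \<psi> f) = campanato_norm \<alpha> p \<phi> h"
    using \<alpha>1 H_eq measurable_h by (rule campanato_norm_cong_AE)
  also have "\<dots> \<le> ennreal (n * c)" by (rule campanato_norm_h)
  also have "\<dots> = hausdorff_const \<alpha> \<phi> \<psi> * campanato_norm \<alpha> p \<phi> f"
    unfolding n c using n(2) c(2) by (simp add: ennreal_mult mult.commute)
  finally show "campanato_norm \<alpha> p \<phi> (dunkl_hausdorff \<alpha> \<psi> f) \<le> hausdorff_const \<alpha> \<phi> \<psi> * campanato_norm \<alpha> p \<phi> f" .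
qed

theorem theorem3p3:
  fixes \<alpha> p :: real and \<phi> :: "real \<Rightarrow> real" and \<psi> :: "real \<Rightarrow> complex"
  assumes "\<alpha> \<ge> -1/2" and "1 \<le> p"
    and "\<And>r. 0 < r \<Longrightarrow> 0 < \<phi> r"
    and "\<phi> \<in> borel_measurable (lebesgue_on {0<..})"
    and "almost_decreasing \<phi>"
    and "almost_increasing (\<lambda>r. r powr (dunkl_dim \<alpha> / p) * \<phi> r)"
    and "\<psi> \<in> borel_measurable lebesgue"
    and "hausdorff_const \<alpha> \<phi> \<psi> < \<infinity>"
  shows "dunkl_hausdorff \<alpha> \<psi> \<in> campanato_space \<alpha> p \<phi> \<rightarrow> campanato_space \<alpha> p \<phi>
    \<and> (\<exists>C::real. \<forall>f\<in>campanato_space \<alpha> p \<phi>.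
          campanato_norm \<alpha> p \<phi> (dunkl_hausdorff \<alpha> \<psi> f) \<le> ennreal C * campanato_norm \<alpha> p \<phi> f)
    \<and> (\<forall>f\<in>campanato_space \<alpha> p \<phi>.
          campanato_norm \<alpha> p \<phi> (dunkl_hausdorff \<alpha> \<psi> f)
            \<le> hausdorff_const \<alpha> \<phi> \<psi> * campanato_norm \<alpha> p \<phi> f)"
proof -
  have bound: "dunkl_hausdorff \<alpha> \<psi> f \<in> borel_measurable lebesgue"
      "campanato_norm \<alpha> p \<phi> (dunkl_hausdorff \<alpha> \<psi> f) \<le> hausdorff_const \<alpha> \<phi> \<psi> * campanato_norm \<alpha> p \<phi> f"
    if "f \<in> campanato_space \<alpha> p \<phi>" for f
    using that dunkl_hausdorff_bound[OF assms(1-4,7,8), of f]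
    by (auto simp: campanato_space_def locally_p_integrable_def)
  have "dunkl_hausdorff \<alpha> \<psi> f \<in> campanato_space \<alpha> p \<phi>" if f: "f \<in> campanato_space \<alpha> p \<phi>" for f
  proof -
    have "hausdorff_const \<alpha> \<phi> \<psi> * campanato_norm \<alpha> p \<phi> f < \<infinity>"
      using f assms(8) by (simp add: campanato_space_def ennreal_mult_less_top)
    with bound(2)[OF f] have "campanato_norm \<alpha> p \<phi> (dunkl_hausdorff \<alpha> \<psi> f) < \<infinity>"
      by (rule order_le_less_trans)
    then show ?thesis
      using locally_p_integrableI[OF assms(1-3) bound(1)[OF f]] by (simp add: campanato_space_def)
  qed
  moreover have "ennreal (enn2real (hausdorff_const \<alpha> \<phi> \<psi>)) = hausdorff_const \<alpha> \<phi> \<psi>"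
    using assms(8) by simp
  ultimately show ?thesis
    using bound(2) by (intro conjI exI[of _ "enn2real (hausdorff_const \<alpha> \<phi> \<psi>)"]) auto
qed

end
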